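(* (Weak version of the Moving Particle Lemma) Let $\alpha\in(0,\alpha_0]$. For $\mathbb{Q}$-a.a. $\omega$ the following holds. For every $L>0$ there exists a positive constant $\kappa=\kappa(L,\alpha)$ such that $$\frac{\varepsilon^{-2}\varphi(\rho_* )}{N^d(\varepsilon N)^{2d}(2\ell+1)^{2d}}\sum_{x\in\Lambda_N}\ \sum_{y\in\Lambda_{x,\varepsilon N}}\ \sum_{\substack{z\in\Lambda_{x,\varepsilon N}:\\|z-y|_\infty\ge2\ell}}\ \sum_{u\in\Gamma_{y,\ell,\alpha}}\ \sum_{v\in\Gamma_{z,\ell,\alpha}}\nu_{\rho_*}\big((\nabla_{u,v}\sqrt f)^2\big)\ \le\ \frac{N^{2-d}\,\mathcal{D}(f)}{\kappa}\ \le\ \frac{C_0}{\kappa}$$ for all $N\ge 1$, $\ell$, $\varepsilon>0$, $C_0>0$ and every function $f\in\Upsilon^\sharp_{C_0,N}$.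
   Context: Environment. Let $d\ge2$ and let $\mathbb{E}_d$ be the set of non-oriented nearest-neighbour bonds of $\mathbb{Z}^d$. The environment $\omega=(\omega(b):b\in\mathbb{E}_d)$ is i.i.d. with values in $[0,c_0]$ ($c_0>0$ fixed), with law $\mathbb{Q}$; $\omega(x,y)=\omega(y,x)=\omega(\{x,y\})$. Assume $\mathbb{Q}(\omega(b)>0)$ is supercritical for Bernoulli bond percolation on $\mathbb{Z}^d$; $\mathcal{C}(\omega)$ is the ($\mathbb{Q}$-a.s. unique) infinite cluster of bonds with $\omega(b)>0$. Let $\hat\omega_\alpha(b)=\mathbb{I}(\omega(b)>\alpha)$ and fix $\alpha_0>0$ such that $\hat\omega_\alpha$ is a supercritical Bernoulli bond percolation for every $\alpha\in(0,\alpha_0]$; $\mathcal{C}_\alpha$ is its infinite cluster. $\mathbb{N}=\{0,1,\dots\}$. Zero range quantities. $g:\mathbb{N}\to[0,\infty)$ is nondecreasing, $g(0)=0$, $g(k)>0$ for $k>0$, $\sup_k|g(k+1)-g(k)|<\infty$. Let $g(0)!=1$, $g(k)!=g(1)\cdots g(k)$, $Z(\varphi)=\sum_k\varphi^k/g(k)!$ with radius of convergence $\varphi_c\in(0,\infty]$ and $\lim_{\varphi\uparrow\varphi_c}Z(\varphi)=\infty$. $\bar\nu_\varphi$ ($0\le\varphi<\varphi_c$) is the product measure on $\mathbb{N}^{\mathcal{C}(\omega)}$ with $\bar\nu_\varphi(\eta(x)=k)=Z(\varphi)^{-1}\varphi^k/g(k)!$; $\varphi(\rho)$ is the unique value with $\bar\nu_{\varphi(\rho)}(\eta(x))=\rho$,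 and $\nu_\rho=\bar\nu_{\varphi(\rho)}$. Fix $\rho_*>0$. The Dirichlet form is $\mathcal{D}(f)=\nu_{\rho_*}(\sqrt f,-\mathcal{L}\sqrt f)=\frac12\sum_{x}\sum_{e}\omega(x,x+e)\,\nu_{\rho_*}\big[g(\eta(x))(\sqrt f(\eta^{x,x+e})-\sqrt f(\eta))^2\big]$, the sum over $x\in\mathcal{C}(\omega)$ and $e\in\{\pm e_1,\dots,\pm e_d\}$ with $x+e\in\mathcal{C}(\omega)$, where $\eta^{x,y}$ is $\eta$ with one particle moved from $x$ to $y$. For a site $z$, $\eta^{z,+}=\eta+\delta_z$, and $\nabla_{u,v}h(\eta)=h(\eta^{u,+})-h(\eta^{v,+})$. Macroscopic field (Antal–Pisztora renormalization). For a positive integer $K$ put $\Lambda_{x,k}=x+([-k,k]^d\cap\mathbb{Z}^d)$, $\Lambda_k=\Lambda_{0,k}$, $\Delta_{\mathbf a,s}=\Lambda_{(2K+1)\mathbf a,s}$ for $\mathbf a\in\mathbb{Z}^d$. $\sigma=(\sigma(\mathbf a))_{\mathbf a\in\mathbb{Z}^d}\in\{0,1\}^{\mathbb{Z}^d}$ is a random field, $\sigma(\mathbf a)$ being a function of $\hat\omega_\alpha$ restricted to $\Delta_{\mathbf a,5K/4}$. A site $\mathbf a$ is white if $\sigma(\mathbf a)=1$ and black if $\sigma(\mathbf a)=0$. $\mathbf C^*_{\mathbf a}$ is the $*$-connected cluster of black sites containing $\mathbf a$ (adjacency $|\cdot|_\infty$-distance $1$), empty if $\mathbf a$ is white; $\bar{\mathbf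 C}^*_{\mathbf a}=\mathbf C^*_{\mathbf a}\cup\partial^{out}\mathbf C^*_{\mathbf a}$, where $\partial^{out}\Lambda=\{x\notin\Lambda:\exists y\in\Lambda,\{x,y\}\in\mathbb{E}_d\}$, with $\bar{\mathbf C}^*_{\mathbf a}=\{\mathbf a\}$ if $\mathbf a$ is white. For $x\in\mathbb{Z}^d$, $\mathbf a(x)$ is the unique site with $x\in\Delta_{\mathbf a(x),K}$, and $\mathbf A_{x,y}$ is the macroscopic nearest-neighbour path from $\mathbf a(x)$ to $\mathbf a(y)$ that adjusts the coordinates one after the other, in the order $1,\dots,d$. The field $\sigma$ has the following properties, $K$ being fixed large enough: (1) $\sigma$ stochastically dominates a Bernoulli site percolation of parameter $\bar p(K)$, where $\bar p(K)\to1$ as $K\to\infty$, $\bar p(K)$ is supercritical, and the $*$-connected cluster of closed sites containing the origin has finite mean size under the Bernoulli law; (2) $\mathbb{Q}$-a.s., any $x,y\in\mathcal{C}_\alpha$ are joined by a path $\gamma_{x,y}$ inside $\mathcal{C}_\alpha$ (made of bonds with $\hat\omega_\alpha=1$) contained in $W_{x,y}=\bigcup_{\mathbf a\in\mathbf A_{x,y}}\bigcup_{\mathbf w\in\bar{\mathbf C}^*_{\mathbf a}}\Delta_{\mathbf w,5K/4}$. Bad and good points. For $L>0$: $\mathbf B(L)=\{\mathbf a:|\mathbf C^*_{\mathbf a}|>L\}$, $B(L)=\bigcup_{\mathbf a\in\mathbf B(L)}\Delta_{\mathbf a,10K}$, $\Gamma_{u,\ell,\alpha}=(\Lambda_{u,\ell}\cap\mathcal{C}_\alpha)\setminus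 B(L)$, $G_N=(\Lambda_{N+1}\cap\mathcal{C}_\alpha)\setminus B(L)$, and $\mathcal{F}_N$ is the $\sigma$-algebra generated by $\{\eta(x):x\in G_N\}$. $\Upsilon^\sharp_{C_0,N}$ is the set of $\mathcal{F}_N$-measurable $f:\mathbb{N}^{\mathcal{C}(\omega)}\to[0,\infty)$ with $\nu_{\rho_*}(f)=1$ and $\mathcal{D}(f)\le C_0N^{d-2}$. *)

theory Defs
  imports "HOL-Probability.Probability"
begin

section \<open>The lattice\<close>

text \<open>
  Sites of \<open>\<int>\<^sup>d\<close> are vectors \<open>int ^ 'd\<close>.  The index type carries a linear order because the
  macroscopic paths below adjust the coordinates in the order \<open>1, \<dots>, d\<close>.
\<close>

type_synonym 'd site = "int ^ 'd"
type_synonym 'd bond = "(int ^ 'd) set"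

definition sup_norm :: "'d::finite site \<Rightarrow> int" where
  "sup_norm x = Max (range (\<lambda>i. \<bar>x $ i\<bar>))"

definition nn_adj :: "'d::finite site \<Rightarrow> 'd site \<Rightarrow> bool" where
  "nn_adj x y \<longleftrightarrow> (\<Sum>i\<in>UNIV. \<bar>x $ i - y $ i\<bar>) = 1"

definition star_adj :: "'d::finite site \<Rightarrow> 'd site \<Rightarrow> bool" where
  "star_adj x y \<longleftrightarrow> sup_norm (x - y) = 1"

definition bonds :: "'d::finite bond set" where
  "bonds = {{x, y} | x y. nn_adj x y}"

definition unit_steps :: "'d::finite site set" where
  "unit_steps = {axis i s | i s. s \<in> {1, -1}}"

text \<open>The radius is real, since radii such as \<open>\<epsilon>N\<close> and \<open>5K/4\<close> need not be integers.\<close>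

definition lbox :: "'d::finite site \<Rightarrow> real \<Rightarrow> 'd site set" where
  "lbox x r = {y. \<forall>i. real_of_int \<bar>y $ i - x $ i\<bar> \<le> r}"

definition outer_boundary :: "'d::finite site set \<Rightarrow> 'd site set" where
  "outer_boundary A = {x. x \<notin> A \<and> (\<exists>y\<in>A. {x, y} \<in> bonds)}"


section \<open>Percolation\<close>

text \<open>Cardinality with value \<open>\<infinity>\<close> on infinite sets (unlike \<open>card\<close>).\<close>

definition esize :: "'a set \<Rightarrow> ennreal" where
  "esize A = emeasure (count_space UNIV) A"

definition bond_cluster :: "('d::finite bond \<Rightarrow> bool) \<Rightarrow> 'd site \<Rightarrow> 'd site set" where
  "bond_cluster h x = {y. (\<lambda>u v. {u, v} \<in> bonds \<and> h {u, v})\<^sup>*\<^sup>* x y}"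

text \<open>
  The union of all infinite clusters; it is \<^emph>\<open>the\<close> infinite cluster whenever the latter is unique,
  which is almost surely the case for supercritical Bernoulli bond percolation.
\<close>

definition infinite_cluster :: "('d::finite bond \<Rightarrow> bool) \<Rightarrow> 'd site set" where
  "infinite_cluster h = {x. infinite (bond_cluster h x)}"

definition bernoulli_bond :: "real \<Rightarrow> ('d::finite bond \<Rightarrow> bool) measure" where
  "bernoulli_bond p = (\<Pi>\<^sub>M b\<in>bonds. measure_pmf (bernoulli_pmf p))"

definition pc_bond :: "'d::finite itself \<Rightarrow> real" where
  "pc_bond _ = Sup {p \<in> {0..1}.
     measure (bernoulli_bond p)
       {h \<in> space (bernoulli_bond p). infinite (bond_cluster h (0 :: 'd site))} = 0}"

text \<open>
  The cluster of \<open>a\<close> formed by the sites satisfying \<open>s\<close>, for the adjacency relation \<open>adj\<close>;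
  it is empty if \<open>a\<close> itself does not satisfy \<open>s\<close>.
\<close>

definition site_cluster ::
  "('d::finite site \<Rightarrow> 'd site \<Rightarrow> bool) \<Rightarrow> ('d site \<Rightarrow> bool) \<Rightarrow> 'd site \<Rightarrow> 'd site set" where
  "site_cluster adj s a =
     (if s a then {b. (\<lambda>x y. s x \<and> s y \<and> adj x y)\<^sup>*\<^sup>* a b} else {})"

definition bernoulli_site :: "real \<Rightarrow> ('d::finite site \<Rightarrow> bool) measure" where
  "bernoulli_site p = (\<Pi>\<^sub>M a\<in>UNIV. measure_pmf (bernoulli_pmf p))"

definition pc_site :: "'d::finite itself \<Rightarrow> real" where
  "pc_site _ = Sup {p \<in> {0..1}.
     measure (bernoulli_site p)
       {s \<in> space (bernoulli_site p). infinite (site_cluster nn_adj s (0 :: 'd site))} = 0}"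

text \<open>Stochastic domination of \<open>M'\<close> by \<open>M\<close>, tested on increasing events.\<close>

definition stoch_dominates :: "('a \<Rightarrow> bool) measure \<Rightarrow> ('a \<Rightarrow> bool) measure \<Rightarrow> bool" where
  "stoch_dominates M M' \<longleftrightarrow>
     (\<forall>A \<in> sets M'. (\<forall>s\<in>A. \<forall>t\<in>space M'. s \<le> t \<longrightarrow> t \<in> A) \<longrightarrow> emeasure M' A \<le> emeasure M A)"


section \<open>The environment\<close>

text \<open>The law of i.i.d. conductances with one-bond marginal \<open>\<mu>\<close>.\<close>

definition env_law :: "real measure \<Rightarrow> ('d::finite bond \<Rightarrow> real) measure" where
  "env_law \<mu> = (\<Pi>\<^sub>M b\<in>bonds. \<mu>)"

definition hat :: "real \<Rightarrow> ('d::finite bond \<Rightarrow> real) \<Rightarrow> 'd bond \<Rightarrow> bool" where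
  "hat \<alpha> \<omega> b \<longleftrightarrow> \<omega> b > \<alpha>"

text \<open>The infinite cluster \<open>\<C>\<^sub>\<alpha>\<close>; the cluster \<open>\<C>(\<omega>)\<close> is the case \<open>\<alpha> = 0\<close>.\<close>

definition clus :: "real \<Rightarrow> ('d::finite bond \<Rightarrow> real) \<Rightarrow> 'd site set" where
  "clus \<alpha> \<omega> = infinite_cluster (hat \<alpha> \<omega>)"


section \<open>The zero range process\<close>

definition gfact :: "(nat \<Rightarrow> real) \<Rightarrow> nat \<Rightarrow> real" where
  "gfact g k = (\<Prod>i=1..k. g i)"

definition Zfun :: "(nat \<Rightarrow> real) \<Rightarrow> real \<Rightarrow> real" where
  "Zfun g \<phi> = (\<Sum>k. \<phi> ^ k / gfact g k)"

definition phi_crit :: "(nat \<Rightarrow> real) \<Rightarrow> ereal" where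
  "phi_crit g = conv_radius (\<lambda>k. 1 / gfact g k)"

definition zero_range_rate :: "(nat \<Rightarrow> real) \<Rightarrow> bool" where
  "zero_range_rate g \<longleftrightarrow>
     mono g \<and> g 0 = 0 \<and> (\<forall>k>0. g k > 0) \<and>
     bdd_above (range (\<lambda>k. \<bar>g (k + 1) - g k\<bar>)) \<and>
     0 < phi_crit g \<and>
     filterlim (\<lambda>\<phi>. Zfun g (real_of_ereal \<phi>)) at_top (at_left (phi_crit g))"

definition marginal :: "(nat \<Rightarrow> real) \<Rightarrow> real \<Rightarrow> nat pmf" where
  "marginal g \<phi> = embed_pmf (\<lambda>k. \<phi> ^ k / gfact g k / Zfun g \<phi>)"

definition nu_bar :: "(nat \<Rightarrow> real) \<Rightarrow> 'd::finite site set \<Rightarrow> real \<Rightarrow> ('d site \<Rightarrow> nat) measure" where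
  "nu_bar g C \<phi> = (\<Pi>\<^sub>M x\<in>C. measure_pmf (marginal g \<phi>))"

definition phi_of :: "(nat \<Rightarrow> real) \<Rightarrow> real \<Rightarrow> real" where
  "phi_of g \<rho> =
     (THE \<phi>. 0 \<le> \<phi> \<and> ereal \<phi> < phi_crit g \<and> measure_pmf.expectation (marginal g \<phi>) real = \<rho>)"

definition nu :: "(nat \<Rightarrow> real) \<Rightarrow> real \<Rightarrow> 'd::finite site set \<Rightarrow> ('d site \<Rightarrow> nat) measure" where
  "nu g \<rho> C = nu_bar g C (phi_of g \<rho>)"

definition add_particle :: "'d site \<Rightarrow> ('d site \<Rightarrow> nat) \<Rightarrow> 'd site \<Rightarrow> nat" where
  "add_particle z \<eta> = \<eta>(z := \<eta> z + 1)"

text \<open>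
  Truncated subtraction is harmless: the jump from \<open>x\<close> is always weighted by \<open>g (\<eta> x)\<close>,
  which vanishes if \<open>\<eta> x = 0\<close>.
\<close>

definition move_particle :: "'d site \<Rightarrow> 'd site \<Rightarrow> ('d site \<Rightarrow> nat) \<Rightarrow> 'd site \<Rightarrow> nat" where
  "move_particle x y \<eta> = add_particle y (\<eta>(x := \<eta> x - 1))"

definition grad :: "'d site \<Rightarrow> 'd site \<Rightarrow> (('d site \<Rightarrow> nat) \<Rightarrow> real) \<Rightarrow> ('d site \<Rightarrow> nat) \<Rightarrow> real" where
  "grad u v h \<eta> = h (add_particle u \<eta>) - h (add_particle v \<eta>)"

definition dirichlet ::
  "(nat \<Rightarrow> real) \<Rightarrow> real \<Rightarrow> ('d::finite bond \<Rightarrow> real) \<Rightarrow> (('d site \<Rightarrow> nat) \<Rightarrow> real) \<Rightarrow> ennreal" where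
  "dirichlet g \<rho> \<omega> f =
     (\<Sum>\<^sub>\<infinity>x\<in>clus 0 \<omega>. \<Sum>e\<in>{e \<in> unit_steps. x + e \<in> clus 0 \<omega>}.
        ennreal (\<omega> {x, x + e}) *
        (\<integral>\<^sup>+\<eta>. ennreal (g (\<eta> x) * (sqrt (f (move_particle x (x + e) \<eta>)) - sqrt (f \<eta>))\<^sup>2)
           \<partial>nu g \<rho> (clus 0 \<omega>))) / 2"


section \<open>The macroscopic field\<close>

text \<open>
  A macroscopic configuration is a predicate \<open>s\<close> on sites, \<open>s a\<close> meaning that \<open>a\<close> is white
  and \<open>\<not> s a\<close> that it is black.
\<close>

definition mblock :: "nat \<Rightarrow> 'd::finite site \<Rightarrow> real \<Rightarrow> 'd site set" where
  "mblock K a r = lbox (\<chi> i. (2 * int K + 1) * a $ i) r"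

definition black_cluster :: "('d::finite site \<Rightarrow> bool) \<Rightarrow> 'd site \<Rightarrow> 'd site set" where
  "black_cluster s a = site_cluster star_adj (\<lambda>b. \<not> s b) a"

definition black_hull :: "('d::finite site \<Rightarrow> bool) \<Rightarrow> 'd site \<Rightarrow> 'd site set" where
  "black_hull s a =
     (if s a then {a} else black_cluster s a \<union> outer_boundary (black_cluster s a))"

definition macro_site :: "nat \<Rightarrow> 'd::finite site \<Rightarrow> 'd site" where
  "macro_site K x = (THE a. x \<in> mblock K a (real K))"

text \<open>
  The set of sites visited by the path from \<open>a\<close> to \<open>b\<close> that adjusts the coordinates in increasing
  order: while coordinate \<open>i\<close> is being adjusted, the coordinates \<open>j < i\<close> already agree with \<open>b\<close>
  and the coordinates \<open>j > i\<close> still agree with \<open>a\<close>.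
\<close>

definition coord_path :: "'d::{finite,linorder} site \<Rightarrow> 'd site \<Rightarrow> 'd site set" where
  "coord_path a b =
     (\<Union>i. {c. (\<forall>j<i. c $ j = b $ j) \<and> (\<forall>j>i. c $ j = a $ j) \<and>
              min (a $ i) (b $ i) \<le> c $ i \<and> c $ i \<le> max (a $ i) (b $ i)})"

definition macro_path :: "nat \<Rightarrow> 'd::{finite,linorder} site \<Rightarrow> 'd site \<Rightarrow> 'd site set" where
  "macro_path K x y = coord_path (macro_site K x) (macro_site K y)"

definition W_region ::
  "nat \<Rightarrow> ('d::{finite,linorder} site \<Rightarrow> bool) \<Rightarrow> 'd site \<Rightarrow> 'd site \<Rightarrow> 'd site set" where
  "W_region K s x y =
     (\<Union>a\<in>macro_path K x y. \<Union>w\<in>black_hull s a. mblock K w (5 * real K / 4))"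

definition joined_within ::
  "('d::finite bond \<Rightarrow> bool) \<Rightarrow> 'd site set \<Rightarrow> 'd site \<Rightarrow> 'd site \<Rightarrow> bool" where
  "joined_within h S x y \<longleftrightarrow>
     (\<exists>\<gamma>. \<gamma> \<noteq> [] \<and> hd \<gamma> = x \<and> last \<gamma> = y \<and> set \<gamma> \<subseteq> S \<and>
          successively (\<lambda>u v. {u, v} \<in> bonds \<and> h {u, v}) \<gamma>)"

text \<open>
  The field is \<open>\<sigma> (hat \<alpha> \<omega>)\<close>.  By the first clause \<open>\<sigma>(a)\<close> only depends on the bonds inside
  \<open>\<Delta>\<^bsub>a,5K/4\<^esub>\<close>, hence on finitely many bonds, so that the field is measurable.  The remaining clauses
  are the Antal--Pisztora properties: comparison with a highly supercritical Bernoulli site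
  percolation, and connectivity inside \<open>W\<^bsub>x,y\<^esub>\<close>.
\<close>

definition renormalized_field ::
  "real measure \<Rightarrow> real \<Rightarrow> (nat \<Rightarrow> real) \<Rightarrow> nat \<Rightarrow>
     (('d::{finite,linorder} bond \<Rightarrow> bool) \<Rightarrow> 'd site \<Rightarrow> bool) \<Rightarrow> bool" where
  "renormalized_field \<mu> \<alpha> pbar K \<sigma> \<longleftrightarrow>
     (\<forall>a h h'. (\<forall>b\<in>bonds. b \<subseteq> mblock K a (5 * real K / 4) \<longrightarrow> h b = h' b) \<longrightarrow> \<sigma> h a = \<sigma> h' a) \<and>
     stoch_dominates
       (distr (env_law \<mu>) (\<Pi>\<^sub>M a\<in>UNIV. count_space UNIV) (\<lambda>\<omega>. \<sigma> (hat \<alpha> \<omega>)))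
       (bernoulli_site (pbar K)) \<and>
     pbar \<longlonglongrightarrow> 1 \<and>
     pc_site TYPE('d) < pbar K \<and> pbar K \<le> 1 \<and>
     (\<integral>\<^sup>+s. esize (black_cluster s (0 :: 'd site)) \<partial>bernoulli_site (pbar K)) < \<infinity> \<and>
     (AE \<omega> in env_law \<mu>. \<forall>x\<in>clus \<alpha> \<omega>. \<forall>y\<in>clus \<alpha> \<omega>.
        joined_within (hat \<alpha> \<omega>) (clus \<alpha> \<omega> \<inter> W_region K (\<sigma> (hat \<alpha> \<omega>)) x y) x y)"


section \<open>Good points\<close>

definition bad_sites :: "('d::finite site \<Rightarrow> bool) \<Rightarrow> real \<Rightarrow> 'd site set" where
  "bad_sites s L = {a. esize (black_cluster s a) > ennreal L}"

definition bad_region :: "nat \<Rightarrow> ('d::finite site \<Rightarrow> bool) \<Rightarrow> real \<Rightarrow> 'd site set" where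
  "bad_region K s L = (\<Union>a\<in>bad_sites s L. mblock K a (10 * real K))"

text \<open>
  With \<open>C = \<C>\<^sub>\<alpha>\<close>: \<open>good_points K s L C u l\<close> is \<open>\<Gamma>\<^bsub>u,l,\<alpha>\<^esub>\<close>, and \<open>good_points K s L C 0 (N + 1)\<close>
  is \<open>G\<^sub>N\<close>.
\<close>

definition good_points ::
  "nat \<Rightarrow> ('d::finite site \<Rightarrow> bool) \<Rightarrow> real \<Rightarrow> 'd site set \<Rightarrow> 'd site \<Rightarrow> real \<Rightarrow> 'd site set" where
  "good_points K s L C u r = (lbox u r \<inter> C) - bad_region K s L"

text \<open>
  The \<open>\<sigma>\<close>-algebra on \<open>\<nat>\<^sup>C\<close> (as extensional functions) generated by the coordinates in \<open>G\<close>.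
\<close>

definition coord_algebra :: "'d site set \<Rightarrow> 'd site set \<Rightarrow> ('d site \<Rightarrow> nat) measure" where
  "coord_algebra C G =
     sigma (C \<rightarrow>\<^sub>E UNIV) {{\<eta> \<in> C \<rightarrow>\<^sub>E UNIV. \<eta> x \<in> A} | x A. x \<in> G}"

definition Upsilon_sharp ::
  "(nat \<Rightarrow> real) \<Rightarrow> real \<Rightarrow> nat \<Rightarrow> (('d::finite bond \<Rightarrow> bool) \<Rightarrow> 'd site \<Rightarrow> bool) \<Rightarrow> real \<Rightarrow> real \<Rightarrow>
     ('d bond \<Rightarrow> real) \<Rightarrow> real \<Rightarrow> nat \<Rightarrow> (('d site \<Rightarrow> nat) \<Rightarrow> real) set" where
  "Upsilon_sharp g \<rho> K \<sigma> \<alpha> L \<omega> C0 N =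
     {f. f \<in> borel_measurable (coord_algebra (clus 0 \<omega>)
              (good_points K (\<sigma> (hat \<alpha> \<omega>)) L (clus \<alpha> \<omega>) 0 (real N + 1))) \<and>
         (\<forall>\<eta> \<in> clus 0 \<omega> \<rightarrow>\<^sub>E UNIV. 0 \<le> f \<eta>) \<and>
         (\<integral>\<^sup>+\<eta>. ennreal (f \<eta>) \<partial>nu g \<rho> (clus 0 \<omega>)) = 1 \<and>
         dirichlet g \<rho> \<omega> f \<le> ennreal (C0 * real N ^ (CARD('d) - 2))}"

end

theory Submission
  imports Defs
begin

text \<open>
  Write \<open>h x = sqrt (f (\<eta> + \<delta>\<^sub>x))\<close>.  Since \<open>f\<close> only depends on the coordinates in \<open>G\<^sub>N\<close>, \<open>h\<close> is constant off
  \<open>G\<^sub>N\<close>; hence along the path from \<open>u\<close> to \<open>v\<close> inside \<open>W\<^bsub>u,v\<^esub>\<close> only the bonds touching \<open>G\<^sub>N\<close> contribute to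
  \<open>h u - h v\<close>.  A point of \<open>G\<^sub>N \<inter> W\<^bsub>u,v\<^esub>\<close> lies in a block near a macroscopic site of \<open>\<^bold>A\<^bsub>u,v\<^esub>\<close> whose black
  cluster has size at most \<open>L\<close> (all blocks near larger clusters lie in the bad region), so there are
  only \<open>O(\<epsilon>N)\<close> such points.  By Cauchy--Schwarz \<open>(h u - h v)\<^sup>2\<close> is at most \<open>O(\<epsilon>N)\<close> times the energy of
  these bonds.  Summing over \<open>u, v\<close>, each macroscopic site is used by \<open>O((\<epsilon>N)\<^bsup>d+1\<^esup>)\<close> pairs, which
  gives the factor \<open>(\<epsilon>N)\<^sup>2\<close> and, after normalisation, \<open>N\<^bsup>2-d\<^esup>\<close>.  The energies are turned into the
  Dirichlet form by \<open>\<nu>(g(\<eta> x) F(\<eta> - \<delta>\<^sub>x)) = \<phi>(\<rho>\<^sub>*) \<nu>(F)\<close>.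
\<close>

section \<open>The fugacity\<close>

text \<open>The path from u to v can be arbitrarily long and the black clusters in
  \<open>W_region\<close> arbitrarily large, so a length bound is out of reach; the estimate
  therefore counts visited points of \<open>G\<close> and never steps. Everything after it is double
  counting with multiplicities that depend only on d, K and L, up to powers of \<epsilon>N and 2l +
  1; hence \<kappa> is deterministic. The separation of y and z by 2l forces l \<le> \<epsilon>N,
  which makes the counts uniform in l. Additive constants can be absorbed into multiples of
  \<epsilon>N only if \<epsilon>N \<ge> 1; below that all boxes are single points and the left side
  is zero. The dependence of \<kappa> on \<alpha> comes from the conductances: bonds of the paths
  have \<omega> > \<alpha>, at the price of a factor 1/\<alpha>. The fugacity is a definite
  description, so removing a particle costs a factor \<phi>(\<rho>) only after existence and
  uniqueness are shown; for a finite critical value, existence rests on the divergence of the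
  partition function.\<close>

lemma gfact_Suc: "gfact g (Suc k) = gfact g k * g (Suc k)"
  by (simp add: gfact_def)

lemma gfact_pos: "zero_range_rate g \<Longrightarrow> gfact g k > 0"
  by (auto simp: gfact_def zero_range_rate_def intro!: prod_pos)

section \<open>The partition function and the first moment as power series\<close>

text \<open>Inside the radius of convergence this is \<phi> times the derivative of
  \<open>Zfun g\<close>, the unnormalised mean of the marginal.\<close>

definition mean_sum :: "(nat \<Rightarrow> real) \<Rightarrow> real \<Rightarrow> real" where
  "mean_sum g \<phi> = (\<Sum>k. real k * (\<phi> ^ k / gfact g k))"

lemma mean_sum_0 [simp]: "mean_sum g 0 = 0"
proof -
  have "(\<lambda>k. real k * (0 ^ k / gfact g k)) = (\<lambda>_. 0)"
    by (auto simp: fun_eq_iff power_0_left)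
  then show ?thesis by (simp add: mean_sum_def)
qed

lemma weights_powser: "(\<lambda>k. \<phi> ^ k / gfact g k) = (\<lambda>k. 1 / gfact g k * \<phi> ^ k)"
  by (simp add: fun_eq_iff)

lemma summable_weights:
  assumes "0 \<le> \<phi>" "ereal \<phi> < phi_crit g"
  shows "summable (\<lambda>k. \<phi> ^ k / gfact g k)"
  unfolding weights_powser using assms by (intro summable_in_conv_radius) (auto simp: phi_crit_def)

lemma ereal_le_less_trans: "x \<le> y \<Longrightarrow> ereal y < c \<Longrightarrow> ereal x < c"
  by (rule le_less_trans[of _ "ereal y"]) auto

lemma radius_between:
  assumes "ereal \<phi> < phi_crit g"
  obtains K where "\<phi> < K" "ereal K < phi_crit g"
  using ereal_dense2[OF assms] that by auto

lemma summable_weights_diffs: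
  assumes "0 \<le> \<phi>" "ereal \<phi> < phi_crit g"
  shows "summable (\<lambda>k. diffs (\<lambda>k. 1 / gfact g k) k * \<phi> ^ k)"
proof -
  obtain K where K: "\<phi> < K" "ereal K < phi_crit g"
    by (rule radius_between[OF assms(2)])
  show ?thesis
  proof (rule termdiff_converges)
    show "norm \<phi> < K" using K assms by simp
    fix x :: real assume "norm x < K"
    then have "ereal (norm x) < phi_crit g"
      using K(2) by (auto intro: ereal_le_less_trans[OF less_imp_le])
    then show "summable (\<lambda>n. 1 / gfact g n * x ^ n)"
      by (intro summable_in_conv_radius) (auto simp: phi_crit_def)
  qed
qed

text \<open>The index shift loses nothing because the term k = 0 vanishes. Writing the series as
  \<phi> times a differentiated power series yields both its summability and its continuity.\<close>

lemma sums_mean_sum_diffs: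
  assumes "0 \<le> \<phi>" "ereal \<phi> < phi_crit g"
  shows "(\<lambda>k. real k * (\<phi> ^ k / gfact g k)) sums
    (\<phi> * (\<Sum>k. diffs (\<lambda>k. 1 / gfact g k) k * \<phi> ^ k))"
proof -
  have "(\<lambda>k. \<phi> * (diffs (\<lambda>k. 1 / gfact g k) k * \<phi> ^ k)) sums
      (\<phi> * (\<Sum>k. diffs (\<lambda>k. 1 / gfact g k) k * \<phi> ^ k))"
    using summable_weights_diffs[OF assms] by (intro sums_mult summable_sums)
  moreover have "(\<lambda>k. \<phi> * (diffs (\<lambda>k. 1 / gfact g k) k * \<phi> ^ k)) =
      (\<lambda>k. real (Suc k) * (\<phi> ^ Suc k / gfact g (Suc k)))"
    by (auto simp: diffs_def fun_eq_iff)
  ultimately show ?thesis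
    using sums_Suc_iff[of "\<lambda>k. real k * (\<phi> ^ k / gfact g k)"] by simp
qed

lemma summable_mean_weights:
  assumes "0 \<le> \<phi>" "ereal \<phi> < phi_crit g"
  shows "summable (\<lambda>k. real k * (\<phi> ^ k / gfact g k))"
  using sums_mean_sum_diffs[OF assms] by (rule sums_summable)

lemma isCont_Zfun:
  assumes "0 \<le> \<phi>" "ereal \<phi> < phi_crit g"
  shows "isCont (Zfun g) \<phi>"
proof -
  obtain K where K: "\<phi> < K" "ereal K < phi_crit g"
    by (rule radius_between[OF assms(2)])
  have "summable (\<lambda>k. 1 / gfact g k * K ^ k)"
    using summable_weights[of K g, unfolded weights_powser] K assms by auto
  then have "isCont (\<lambda>x. \<Sum>k. 1 / gfact g k * x ^ k) \<phi>"
    by (rule isCont_powser) (use K assms in simp)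
  then show ?thesis by (simp add: Zfun_def[abs_def])
qed

lemma continuous_on_mean_sum:
  assumes "ereal b < phi_crit g"
  shows "continuous_on {0..b} (mean_sum g)"
proof -
  have "isCont (\<lambda>x. \<Sum>k. diffs (\<lambda>k. 1 / gfact g k) k * x ^ k) \<phi>" if "0 \<le> \<phi>" "\<phi> \<le> b" for \<phi>
  proof -
    have *: "ereal \<phi> < phi_crit g"
      using that assms by (auto intro: ereal_le_less_trans)
    obtain K where K: "\<phi> < K" "ereal K < phi_crit g"
      by (rule radius_between[OF *])
    show ?thesis
      by (rule isCont_powser[where K=K], rule summable_weights_diffs) (use K that in auto)
  qed
  then have "continuous_on {0..b} (\<lambda>x. x * (\<Sum>k. diffs (\<lambda>k. 1 / gfact g k) k * x ^ k))"
    by (intro continuous_intros continuous_at_imp_continuous_on) auto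
  moreover have "x * (\<Sum>k. diffs (\<lambda>k. 1 / gfact g k) k * x ^ k) = mean_sum g x" if "x \<in> {0..b}" for x
  proof -
    have "ereal x < phi_crit g"
      using that assms by (auto intro: ereal_le_less_trans)
    then show ?thesis
      unfolding mean_sum_def using that by (intro sums_unique sums_mean_sum_diffs) auto
  qed
  ultimately show ?thesis
    by (rule continuous_on_eq)
qed

lemma Zfun_ge_1:
  assumes "zero_range_rate g" "0 \<le> \<phi>" "ereal \<phi> < phi_crit g"
  shows "Zfun g \<phi> \<ge> 1"
proof -
  have "(\<Sum>k<1. \<phi> ^ k / gfact g k) \<le> Zfun g \<phi>"
    unfolding Zfun_def
    by (rule sum_le_suminf)
      (use summable_weights[OF assms(2,3)] gfact_pos[OF assms(1)] assms(2) in
        \<open>auto intro!: divide_nonneg_pos\<close>)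
  then show ?thesis by (simp add: gfact_def)
qed

text \<open>\<open>embed_pmf\<close> returns the prescribed weights only if they are nonnegative
  with total mass one; this is where \<phi> below the critical value is needed.\<close>

lemma pmf_marginal:
  assumes "zero_range_rate g" "0 \<le> \<phi>" "ereal \<phi> < phi_crit g"
  shows "pmf (marginal g \<phi>) k = \<phi> ^ k / gfact g k / Zfun g \<phi>"
  unfolding marginal_def
proof (rule pmf_embed_pmf)
  note Z = Zfun_ge_1[OF assms] and w = summable_weights[OF assms(2,3)]
  show nn: "0 \<le> \<phi> ^ k / gfact g k / Zfun g \<phi>" for k
    using Z gfact_pos[OF assms(1), of k] assms(2) by (auto intro!: divide_nonneg_pos)
  have "(\<lambda>k. \<phi> ^ k / gfact g k / Zfun g \<phi>) sums (Zfun g \<phi> / Zfun g \<phi>)"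
    using w by (intro sums_divide) (simp add: Zfun_def summable_sums)
  then have "(\<Sum>k. ennreal (\<phi> ^ k / gfact g k / Zfun g \<phi>)) = ennreal 1"
    using Z nn by (intro suminf_ennreal_eq) auto
  then show "(\<integral>\<^sup>+k. ennreal (\<phi> ^ k / gfact g k / Zfun g \<phi>) \<partial>count_space UNIV) = 1"
    by (simp add: nn_integral_count_space_nat)
qed

lemma expectation_marginal:
  assumes "zero_range_rate g" "0 \<le> \<phi>" "ereal \<phi> < phi_crit g"
  shows "measure_pmf.expectation (marginal g \<phi>) real = mean_sum g \<phi> / Zfun g \<phi>"
proof -
  note Z = Zfun_ge_1[OF assms]
  have nn: "0 \<le> real k * (\<phi> ^ k / gfact g k) / Zfun g \<phi>" for k
    using Z gfact_pos[OF assms(1), of k] assms(2)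
    by (intro divide_nonneg_nonneg mult_nonneg_nonneg) auto
  have s: "(\<lambda>k. real k * (\<phi> ^ k / gfact g k) / Zfun g \<phi>) sums (mean_sum g \<phi> / Zfun g \<phi>)"
    using summable_mean_weights[OF assms(2,3)]
    by (intro sums_divide) (simp add: mean_sum_def summable_sums)
  have "(\<integral>\<^sup>+k. ennreal (real k) \<partial>measure_pmf (marginal g \<phi>)) =
      (\<Sum>k. ennreal (real k * (\<phi> ^ k / gfact g k) / Zfun g \<phi>))"
    unfolding nn_integral_measure_pmf nn_integral_count_space_nat
    by (intro suminf_cong)
      (simp add: pmf_marginal[OF assms] ennreal_mult'[symmetric] mult.commute)
  also have "\<dots> = ennreal (mean_sum g \<phi> / Zfun g \<phi>)"
    using s nn by (intro suminf_ennreal_eq)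
  finally have "(\<integral>\<^sup>+k. ennreal (real k) \<partial>measure_pmf (marginal g \<phi>)) = ennreal (mean_sum g \<phi> / Zfun g \<phi>)" .
  moreover have "0 \<le> mean_sum g \<phi> / Zfun g \<phi>"
    using nn by (intro sums_le[OF _ sums_zero s])
  ultimately show ?thesis
    by (subst integral_eq_nn_integral) auto
qed

section \<open>Uniqueness and existence of the fugacity\<close>

text \<open>Monotonicity of the mean without derivatives: if two parameters have mean \<rho>, both
  series of weights centred at \<rho> sum to zero, yet a combination of them has nonnegative terms,
  one of them positive.\<close>

lemma mean_inj:
  assumes g: "zero_range_rate g" and r: "\<rho> > 0"
    and \<phi>: "0 \<le> \<phi>" "ereal \<phi> < phi_crit g" "mean_sum g \<phi> / Zfun g \<phi> = \<rho>"
    and \<psi>: "\<phi> < \<psi>" "ereal \<psi> < phi_crit g" "mean_sum g \<psi> / Zfun g \<psi> = \<rho>"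
  shows False
proof -
  have s: "(\<lambda>k. (real k - \<rho>) * (x ^ k / gfact g k)) sums 0"
    if x: "0 \<le> x" "ereal x < phi_crit g" "mean_sum g x / Zfun g x = \<rho>" for x
  proof -
    have "(\<lambda>k. real k * (x ^ k / gfact g k) - \<rho> * (x ^ k / gfact g k)) sums (mean_sum g x - \<rho> * Zfun g x)"
      unfolding mean_sum_def Zfun_def
      using x summable_weights summable_mean_weights
      by (intro sums_diff sums_mult summable_sums) auto
    moreover have "mean_sum g x - \<rho> * Zfun g x = 0"
      using x Zfun_ge_1[OF g x(1,2)] by (auto simp: field_simps)
    ultimately show ?thesis by (simp only: left_diff_distrib)
  qed
  have "\<phi> > 0"
  proof (rule ccontr)
    assume "\<not> \<phi> > 0"
    then have "\<phi> = 0" using \<phi> by simp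
    then show False using \<phi> r by simp
  qed
  define t where "t = \<psi> / \<phi>"
  have t: "t > 1" "\<psi> = t * \<phi>" using \<open>\<phi> > 0\<close> \<psi> by (auto simp: t_def)
  \<comment> \<open>The factor \<open>t powr \<rho>\<close> is chosen so that the k-th term becomes
    (k - \<rho>)(t^k - t^\<rho>) times the weight at \<phi>: both brackets change sign at k =
    \<rho>. At k = 0 the term is positive since \<rho> > 0 and t > 1.\<close>
  let ?d = "\<lambda>k. (real k - \<rho>) * (\<psi> ^ k / gfact g k) - t powr \<rho> * ((real k - \<rho>) * (\<phi> ^ k / gfact g k))"
  have d: "?d k = (real k - \<rho>) * (t powr real k - t powr \<rho>) * (\<phi> ^ k / gfact g k)" for k
    using t by (simp add: powr_realpow algebra_simps diff_divide_distrib power_mult_distrib)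
  have nn: "0 \<le> ?d k" for k
  proof -
    have "0 \<le> (real k - \<rho>) * (t powr real k - t powr \<rho>)"
      using t by (cases "real k \<le> \<rho>") (auto intro!: mult_nonneg_nonneg mult_nonpos_nonpos)
    then show ?thesis
      unfolding d using \<open>\<phi> > 0\<close> gfact_pos[OF g, of k] by (intro mult_nonneg_nonneg[of "_ * _"]) auto
  qed
  have "?d sums (0 - t powr \<rho> * 0)"
    using \<phi> \<psi> by (intro sums_diff sums_mult s) auto
  then have "?d sums 0" by simp
  then have "summable ?d" "suminf ?d = 0"
    using sums_iff by blast+
  then have "?d 0 = 0"
    using iffD1[OF suminf_eq_zero_iff[of ?d]] nn by blast
  moreover have "?d 0 > 0"
  proof -
    have "1 < t powr \<rho>" using t r by (intro gr_one_powr) auto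
    then have "0 < (0 - \<rho>) * (1 - t powr \<rho>)" using r by (intro mult_neg_neg) auto
    then show ?thesis unfolding d using t by (simp add: gfact_def)
  qed
  ultimately show False by (simp only: less_irrefl)
qed

text \<open>For a finite critical value R the partial sum is bounded by its value at R while
  \<open>Zfun\<close> diverges; for an infinite one the single term of index m outgrows all earlier
  ones together.\<close>

lemma Zfun_dominates:
  assumes g: "zero_range_rate g"
  obtains \<phi> where "0 \<le> \<phi>" "ereal \<phi> < phi_crit g"
    "2 * (\<Sum>k<m. \<phi> ^ k / gfact g k) \<le> Zfun g \<phi>"
proof (cases "phi_crit g")
  case (real R)
  have "R > 0" using g real by (auto simp: zero_range_rate_def)
  have "eventually (\<lambda>x. Zfun g (real_of_ereal x) \<ge> 2 * (\<Sum>k<m. R ^ k / gfact g k)) (at_left (phi_crit g))"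
    using g unfolding zero_range_rate_def filterlim_at_top by blast
  then obtain b where b: "b < phi_crit g"
    "\<And>y. y > b \<Longrightarrow> y < phi_crit g \<Longrightarrow> Zfun g (real_of_ereal y) \<ge> 2 * (\<Sum>k<m. R ^ k / gfact g k)"
    using \<open>R > 0\<close> real eventually_at_left[of "0::ereal" "phi_crit g"] by auto
  have "max b 0 < phi_crit g" using b \<open>R > 0\<close> real by simp
  then obtain y where y: "max b 0 < ereal y" "ereal y < phi_crit g"
    using ereal_dense2 by blast
  have "(\<Sum>k<m. y ^ k / gfact g k) \<le> (\<Sum>k<m. R ^ k / gfact g k)"
    using y real gfact_pos[OF g] by (intro sum_mono divide_right_mono power_mono) (auto simp: less_imp_le)
  moreover have "2 * (\<Sum>k<m. R ^ k / gfact g k) \<le> Zfun g y"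
    using b(2)[of "ereal y"] y by simp
  ultimately show ?thesis
    using that[of y] y by auto
next
  case PInf
  define A where "A = (\<Sum>k<m. 1 / gfact g k)"
  have A: "A \<ge> 0" unfolding A_def using gfact_pos[OF g] by (intro sum_nonneg) (simp add: less_imp_le)
  \<comment> \<open>For \<phi> \<ge> 1 the partial sum is at most
    \<open>A * \<phi> ^ (m - 1)\<close>; the other lower bound on \<phi> makes twice this at most
    the term of index m.\<close>
  define \<phi> where "\<phi> = max 1 (2 * A * gfact g m)"
  have \<phi>: "1 \<le> \<phi>" "2 * A * gfact g m \<le> \<phi>" by (auto simp: \<phi>_def)
  have c: "ereal \<phi> < phi_crit g" using PInf by simp
  have pw: "\<phi> ^ k \<le> \<phi> ^ (m - 1)" if "k < m" for k
    using that \<phi> by (intro power_increasing) auto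
  have "2 * (\<Sum>k<m. \<phi> ^ k / gfact g k) \<le> 2 * (\<phi> ^ (m - 1) * A)"
    unfolding A_def sum_distrib_left
    using gfact_pos[OF g] pw by (intro sum_mono mult_left_mono) (auto simp: less_imp_le intro!: divide_right_mono)
  also have "\<dots> \<le> \<phi> ^ m / gfact g m"
  proof (cases m)
    case 0
    then show ?thesis using A by (simp add: A_def gfact_def)
  next
    case (Suc n)
    have "2 * A * gfact g m * \<phi> ^ (m - 1) \<le> \<phi> * \<phi> ^ (m - 1)"
      using \<phi> by (intro mult_right_mono) auto
    then show ?thesis using Suc gfact_pos[OF g, of m] by (simp add: field_simps)
  qed
  also have "\<dots> \<le> (\<Sum>k<Suc m. \<phi> ^ k / gfact g k)"
    using gfact_pos[OF g] \<phi> by (intro member_le_sum) (auto intro!: divide_nonneg_pos)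
  also have "\<dots> \<le> Zfun g \<phi>"
    unfolding Zfun_def using gfact_pos[OF g] \<phi> c
    by (intro sum_le_suminf summable_weights) (auto intro!: divide_nonneg_pos)
  finally show ?thesis using that[of \<phi>] c \<phi> by auto
next
  case MInf
  then show ?thesis using g by (auto simp: zero_range_rate_def)
qed

text \<open>At least half of the mass sits at k \<ge> m, so the mean is at least m/2; hence the
  attained means are unbounded.\<close>

lemma mean_ge:
  assumes g: "zero_range_rate g"
  obtains \<phi> where "0 \<le> \<phi>" "ereal \<phi> < phi_crit g" "real m / 2 * Zfun g \<phi> \<le> mean_sum g \<phi>"
proof -
  obtain \<phi> where \<phi>: "0 \<le> \<phi>" "ereal \<phi> < phi_crit g" "2 * (\<Sum>k<m. \<phi> ^ k / gfact g k) \<le> Zfun g \<phi>"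
    using Zfun_dominates[OF g] .
  let ?w = "\<lambda>k. \<phi> ^ k / gfact g k"
  have w0: "?w k \<ge> 0" for k using \<phi> gfact_pos[OF g, of k] by auto
  have s: "summable ?w" "summable (\<lambda>k. real k * ?w k)"
    using summable_weights summable_mean_weights \<phi> by blast+
  have tail: "(\<Sum>k. ?w (k + m)) = Zfun g \<phi> - (\<Sum>k<m. ?w k)"
    unfolding Zfun_def by (rule suminf_minus_initial_segment[OF s(1)])
  have "real m / 2 * Zfun g \<phi> \<le> real m * (Zfun g \<phi> - (\<Sum>k<m. ?w k))"
    using mult_left_mono[OF \<phi>(3), of "real m / 2"] by (simp add: algebra_simps)
  also have "\<dots> = (\<Sum>k. real m * ?w (k + m))"
    unfolding tail[symmetric] using s by (intro suminf_mult[symmetric]) (simp add: summable_iff_shift[of ?w])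
  also have "\<dots> \<le> (\<Sum>k. real (k + m) * ?w (k + m))"
  proof (rule suminf_le)
    show "real m * ?w (k + m) \<le> real (k + m) * ?w (k + m)" for k
      using w0[of "k + m"] by (intro mult_right_mono) auto
    show "summable (\<lambda>k. real m * ?w (k + m))"
      using s(1) by (intro summable_mult) (simp only: summable_iff_shift[of ?w])
    show "summable (\<lambda>k. real (k + m) * ?w (k + m))"
      using s(2) by (simp only: summable_iff_shift[of "\<lambda>k. real k * ?w k"])
  qed
  also have "\<dots> = mean_sum g \<phi> - (\<Sum>k<m. real k * ?w k)"
    unfolding mean_sum_def by (rule suminf_minus_initial_segment[OF s(2)])
  also have "\<dots> \<le> mean_sum g \<phi>"
    using sum_nonneg[of "{..<m}" "\<lambda>k. real k * ?w k"] w0 by (auto simp del: times_divide_eq_right)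
  finally show ?thesis using that \<phi> by blast
qed

text \<open>A definite description carries no information before existence and uniqueness.
  Intermediate values between 0, where the mean is zero, and a point of mean at least \<rho> give
  the former, \<open>mean_inj\<close> the latter.\<close>

lemma phi_of_bounds:
  assumes g: "zero_range_rate g" and r: "\<rho> > 0"
  shows "0 \<le> phi_of g \<rho>" "ereal (phi_of g \<rho>) < phi_crit g"
proof -
  obtain m where m: "2 * \<rho> \<le> real m" using real_arch_simple by blast
  obtain b where b: "0 \<le> b" "ereal b < phi_crit g" "real m / 2 * Zfun g b \<le> mean_sum g b"
    using mean_ge[OF g] .
  have lt: "ereal x < phi_crit g" if "x \<in> {0..b}" for x
    using that b by (auto intro: ereal_le_less_trans)
  have Z: "Zfun g x \<ge> 1" if "x \<in> {0..b}" for x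
    using that Zfun_ge_1[OF g _ lt] by simp
  have "continuous_on {0..b} (Zfun g)"
    using isCont_Zfun lt by (intro continuous_at_imp_continuous_on) auto
  then have "continuous_on {0..b} (\<lambda>x. mean_sum g x / Zfun g x)"
    using continuous_on_mean_sum[OF b(2)] Z by (intro continuous_intros) force+
  moreover have "mean_sum g 0 / Zfun g 0 \<le> \<rho>"
    using r by simp
  moreover have "\<rho> \<le> mean_sum g b / Zfun g b"
  proof -
    have "\<rho> * Zfun g b \<le> real m / 2 * Zfun g b"
      using m Z[of b] b by (intro mult_right_mono) auto
    then have "\<rho> * Zfun g b \<le> mean_sum g b" using b by linarith
    moreover have "0 < Zfun g b" using Z[of b] b by auto
    ultimately show ?thesis by (simp add: le_divide_eq)
  qed
  ultimately obtain \<phi> where \<phi>: "0 \<le> \<phi>" "\<phi> \<le> b" "mean_sum g \<phi> / Zfun g \<phi> = \<rho>"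
    using IVT'[of "\<lambda>x. mean_sum g x / Zfun g x" 0 \<rho> b] b by auto
  let ?P = "\<lambda>\<phi>. 0 \<le> \<phi> \<and> ereal \<phi> < phi_crit g \<and> measure_pmf.expectation (marginal g \<phi>) real = \<rho>"
  have "\<exists>!\<phi>. ?P \<phi>"
  proof (rule ex1I[of _ \<phi>])
    show "?P \<phi>" using \<phi> lt[of \<phi>] by (simp add: expectation_marginal[OF g])
    fix \<psi> assume "?P \<psi>"
    then have \<psi>: "0 \<le> \<psi>" "ereal \<psi> < phi_crit g" "mean_sum g \<psi> / Zfun g \<psi> = \<rho>"
      by (auto simp: expectation_marginal[OF g])
    show "\<psi> = \<phi>"
    proof (rule linorder_cases)
      assume "\<psi> < \<phi>"
      then show ?thesis using mean_inj[OF g r \<psi> _ lt \<phi>(3)] \<phi> by simp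
    next
      assume "\<phi> < \<psi>"
      then show ?thesis using mean_inj[OF g r \<phi>(1) lt \<phi>(3) _ \<psi>(2,3)] \<phi> by simp
    qed
  qed
  from theI'[OF this] show "0 \<le> phi_of g \<rho>" "ereal (phi_of g \<rho>) < phi_crit g"
    unfolding phi_of_def by blast+
qed


section \<open>Removing a particle under the product measure\<close>

text \<open>Detailed balance of the single-site law: p(k+1) g(k+1) = \<phi> p(k). The term k = 0
  drops out since g(0) = 0, which makes the truncated k - 1 harmless.\<close>

lemma marginal_shift:
  fixes h :: "nat \<Rightarrow> ennreal"
  assumes g: "zero_range_rate g" and \<phi>: "0 \<le> \<phi>" "ereal \<phi> < phi_crit g"
  shows "(\<integral>\<^sup>+k. ennreal (g k) * h (k - 1) \<partial>measure_pmf (marginal g \<phi>)) =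
    ennreal \<phi> * (\<integral>\<^sup>+k. h k \<partial>measure_pmf (marginal g \<phi>))"
proof -
  let ?p = "pmf (marginal g \<phi>)"
  have "(\<integral>\<^sup>+k. ennreal (g k) * h (k - 1) \<partial>measure_pmf (marginal g \<phi>)) =
      (\<Sum>k. ennreal (?p k) * (ennreal (g k) * h (k - 1)))"
    by (simp only: nn_integral_measure_pmf nn_integral_count_space_nat)
  also have "\<dots> = (\<Sum>k. ennreal (?p (k + 1)) * (ennreal (g (k + 1)) * h k))"
    using g by (subst suminf_offset[where i=1]) (auto simp: zero_range_rate_def)
  also have "\<dots> = (\<Sum>k. ennreal \<phi> * (ennreal (?p k) * h k))"
  proof (intro suminf_cong)
    fix k
    have gp: "g (k + 1) > 0" using g by (auto simp: zero_range_rate_def)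
    have "?p (k + 1) * g (k + 1) = \<phi> * ?p k"
      using gp by (simp add: pmf_marginal[OF g \<phi>] gfact_Suc)
    then have "ennreal (?p (k + 1)) * ennreal (g (k + 1)) = ennreal \<phi> * ennreal (?p k)"
      using gp \<phi> by (simp add: ennreal_mult'[symmetric])
    then show "ennreal (?p (k + 1)) * (ennreal (g (k + 1)) * h k) = ennreal \<phi> * (ennreal (?p k) * h k)"
      by (simp only: mult.assoc[symmetric])
  qed
  also have "\<dots> = ennreal \<phi> * (\<integral>\<^sup>+k. h k \<partial>measure_pmf (marginal g \<phi>))"
    by (simp add: nn_integral_measure_pmf nn_integral_count_space_nat)
  finally show ?thesis .
qed

lemma space_nu_bar: "space (nu_bar g C \<phi>) = C \<rightarrow>\<^sub>E UNIV"
  by (simp add: nu_bar_def space_PiM)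

text \<open>The product law is the image of an independent draw of the coordinate a and of all the
  others, so Fubini reduces the claim to \<open>marginal_shift\<close> in the coordinate a.\<close>

lemma nu_bar_shift:
  assumes g: "zero_range_rate g" and \<phi>: "0 \<le> \<phi>" "ereal \<phi> < phi_crit g" and a: "a \<in> C"
    and F[measurable]: "F \<in> borel_measurable (nu_bar g C \<phi>)"
  shows "(\<integral>\<^sup>+\<eta>. ennreal (g (\<eta> a)) * F (\<eta>(a := \<eta> a - 1)) \<partial>nu_bar g C \<phi>) =
    ennreal \<phi> * (\<integral>\<^sup>+\<eta>. F \<eta> \<partial>nu_bar g C \<phi>)"
proof -
  let ?M = "measure_pmf (marginal g \<phi>)"
  let ?P = "\<Pi>\<^sub>M x\<in>C - {a}. ?M"
  let ?u = "\<lambda>(k, X). X(a := k)"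
  interpret P: prob_space ?P by (intro prob_space_PiM measure_pmf.prob_space_axioms)
  interpret MP: pair_sigma_finite ?M ?P ..
  have C: "insert a (C - {a}) = C" using a by auto
  have nu: "nu_bar g C \<phi> = distr (?M \<Otimes>\<^sub>M ?P) (nu_bar g C \<phi>) ?u"
    using distr_pair_PiM_eq_PiM[of "C - {a}" "\<lambda>_. ?M" a] measure_pmf.prob_space_axioms C
    unfolding nu_bar_def by metis
  have u[measurable]: "?u \<in> measurable (?M \<Otimes>\<^sub>M ?P) (nu_bar g C \<phi>)"
    unfolding nu_bar_def split_beta'
    by (rule measurable_fun_upd[where J = "C - {a}"]) (use C in auto)
  have u1[measurable]: "(\<lambda>(k, X). X(a := k - 1)) \<in> measurable (?M \<Otimes>\<^sub>M ?P) (nu_bar g C \<phi>)"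
    unfolding nu_bar_def split_beta'
    by (rule measurable_fun_upd[where J = "C - {a}"]) (use C in auto)
  have m1: "(\<lambda>\<eta>. ennreal (g (\<eta> a)) * F (\<eta>(a := \<eta> a - 1))) \<in> borel_measurable (nu_bar g C \<phi>)"
  proof -
    have comp[measurable]: "(\<lambda>\<eta>. \<eta> a) \<in> measurable (nu_bar g C \<phi>) (count_space UNIV)"
      using measurable_component_singleton[OF a, of "\<lambda>_. ?M"] unfolding nu_bar_def by simp
    have "(\<lambda>\<eta>. \<eta> a - 1) \<in> measurable (nu_bar g C \<phi>) ?M"
      using measurable_compose[OF comp, of "\<lambda>k. k - 1" ?M] by simp
    then have [measurable]: "(\<lambda>\<eta>. \<eta>(a := \<eta> a - 1)) \<in> measurable (nu_bar g C \<phi>) (nu_bar g C \<phi>)"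
      unfolding nu_bar_def
      by (intro measurable_fun_upd[where J = C]) (use a in \<open>auto simp: insert_absorb\<close>)
    show ?thesis by measurable
  qed
  have m2: "(\<lambda>(k, X). ennreal (g k) * F (X(a := k - 1))) \<in> borel_measurable (?M \<Otimes>\<^sub>M ?P)"
    using measurable_compose[OF u1 F] by (simp add: split_beta')
  have m3: "(\<lambda>(k, X). F (X(a := k))) \<in> borel_measurable (?M \<Otimes>\<^sub>M ?P)"
    using measurable_compose[OF u F] by (simp add: split_beta')
  have "(\<integral>\<^sup>+\<eta>. ennreal (g (\<eta> a)) * F (\<eta>(a := \<eta> a - 1)) \<partial>nu_bar g C \<phi>) =
      (\<integral>\<^sup>+(k, X). ennreal (g k) * F (X(a := k - 1)) \<partial>(?M \<Otimes>\<^sub>M ?P))"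
    by (subst nu, subst nn_integral_distr[OF u]) (use m1 in \<open>simp_all add: split_beta'\<close>)
  also have "\<dots> = (\<integral>\<^sup>+X. (\<integral>\<^sup>+k. ennreal (g k) * F (X(a := k - 1)) \<partial>?M) \<partial>?P)"
    using MP.nn_integral_snd[OF m2] by simp
  also have "\<dots> = (\<integral>\<^sup>+X. ennreal \<phi> * (\<integral>\<^sup>+k. F (X(a := k)) \<partial>?M) \<partial>?P)"
    by (simp only: marginal_shift[OF g \<phi>, of "\<lambda>k. F (_(a := k))"])
  also have "\<dots> = ennreal \<phi> * (\<integral>\<^sup>+X. (\<integral>\<^sup>+k. F (X(a := k)) \<partial>?M) \<partial>?P)"
    using measure_pmf.borel_measurable_nn_integral_fst measurable_pair_swap[OF m3]
    by (intro nn_integral_cmult) (simp add: split_beta')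
  also have "(\<integral>\<^sup>+X. (\<integral>\<^sup>+k. F (X(a := k)) \<partial>?M) \<partial>?P) = (\<integral>\<^sup>+(k, X). F (X(a := k)) \<partial>(?M \<Otimes>\<^sub>M ?P))"
    using MP.nn_integral_snd[OF m3] by simp
  also have "\<dots> = (\<integral>\<^sup>+\<eta>. F \<eta> \<partial>nu_bar g C \<phi>)"
    using nn_integral_distr[OF u, where f = F, folded nu] F by (simp add: split_beta')
  finally show ?thesis .
qed

lemma measurable_add_particle [measurable]:
  assumes "a \<in> C"
  shows "add_particle a \<in> measurable (nu g \<rho> C) (nu g \<rho> C)"
  unfolding nu_def nu_bar_def add_particle_def
  by (rule measurable_fun_upd[where J = C])
    (use assms measurable_component_singleton[OF assms, of "\<lambda>_. measure_pmf (marginal g (phi_of g \<rho>))"]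
      in \<open>auto simp: insert_absorb\<close>)

text \<open>If a is occupied, the configurations before and after the jump both arise by adding one
  particle, at a or at b, to the configuration with a particle removed from a. The shift of the
  measure then absorbs the rate g.\<close>

lemma nn_integral_jump:
  assumes g: "zero_range_rate g" and r: "\<rho> > 0" and a: "a \<in> C" and b: "b \<in> C"
    and f[measurable]: "f \<in> borel_measurable (nu g \<rho> C)"
  shows "(\<integral>\<^sup>+\<eta>. ennreal (g (\<eta> a) * (sqrt (f (move_particle a b \<eta>)) - sqrt (f \<eta>))\<^sup>2) \<partial>nu g \<rho> C) =
    ennreal (phi_of g \<rho>) * (\<integral>\<^sup>+\<eta>. ennreal ((grad a b (\<lambda>\<xi>. sqrt (f \<xi>)) \<eta>)\<^sup>2) \<partial>nu g \<rho> C)"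
proof -
  let ?F = "\<lambda>\<xi>. ennreal ((sqrt (f (add_particle b \<xi>)) - sqrt (f (add_particle a \<xi>)))\<^sup>2)"
  note [measurable] = measurable_compose[OF measurable_add_particle f, OF a]
    measurable_compose[OF measurable_add_particle f, OF b]
  have "ennreal (g (\<eta> a) * (sqrt (f (move_particle a b \<eta>)) - sqrt (f \<eta>))\<^sup>2) =
      ennreal (g (\<eta> a)) * ?F (\<eta>(a := \<eta> a - 1))" for \<eta>
  proof (cases "\<eta> a = 0")
    case True
    then show ?thesis using g by (simp add: zero_range_rate_def)
  next
    case False
    then have "add_particle a (\<eta>(a := \<eta> a - 1)) = \<eta>"
      by (auto simp: add_particle_def)
    moreover have "g (\<eta> a) \<ge> 0"
      using g False by (auto simp: zero_range_rate_def intro: less_imp_le)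
    ultimately show ?thesis by (simp add: move_particle_def ennreal_mult)
  qed
  then have "(\<integral>\<^sup>+\<eta>. ennreal (g (\<eta> a) * (sqrt (f (move_particle a b \<eta>)) - sqrt (f \<eta>))\<^sup>2) \<partial>nu g \<rho> C) =
      (\<integral>\<^sup>+\<eta>. ennreal (g (\<eta> a)) * ?F (\<eta>(a := \<eta> a - 1)) \<partial>nu g \<rho> C)"
    by simp
  also have "\<dots> = ennreal (phi_of g \<rho>) * (\<integral>\<^sup>+\<eta>. ?F \<eta> \<partial>nu g \<rho> C)"
    unfolding nu_def using phi_of_bounds[OF g r] a
    by (intro nu_bar_shift[OF g]) (auto simp flip: nu_def)
  finally show ?thesis by (simp add: grad_def power2_commute)
qed

section \<open>Functions measurable with respect to the coordinates in a set of sites\<close>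

lemma space_coord_algebra: "space (coord_algebra C G) = C \<rightarrow>\<^sub>E UNIV"
  unfolding coord_algebra_def by (rule space_measure_of) auto

lemma sets_coord_algebra: "sets (coord_algebra C G) =
    sigma_sets (C \<rightarrow>\<^sub>E UNIV) {{\<eta> \<in> C \<rightarrow>\<^sub>E UNIV. \<eta> x \<in> A} | x A. x \<in> G}"
  unfolding coord_algebra_def by (rule sets_measure_of) auto

text \<open>The sets that do not separate \<eta> from \<xi> include the generators and are closed
  under complement and countable union; the level set of f through \<eta> is among them.\<close>

lemma coord_algebra_eq_on:
  fixes f :: "('d::finite site \<Rightarrow> nat) \<Rightarrow> real"
  assumes f: "f \<in> borel_measurable (coord_algebra C G)"
    and \<eta>: "\<eta> \<in> C \<rightarrow>\<^sub>E UNIV" "\<xi> \<in> C \<rightarrow>\<^sub>E UNIV" "\<And>x. x \<in> G \<Longrightarrow> \<eta> x = \<xi> x"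
  shows "f \<eta> = f \<xi>"
proof -
  let ?A = "{{\<eta> \<in> C \<rightarrow>\<^sub>E UNIV. \<eta> x \<in> A} | x A. x \<in> G}"
  have "f -` {f \<eta>} \<inter> space (coord_algebra C G) \<in> sets (coord_algebra C G)"
    using f by measurable
  then have "f -` {f \<eta>} \<inter> (C \<rightarrow>\<^sub>E UNIV) \<in> sigma_sets (C \<rightarrow>\<^sub>E UNIV) ?A"
    unfolding space_coord_algebra sets_coord_algebra .
  moreover have "\<eta> \<in> B \<longleftrightarrow> \<xi> \<in> B" if "B \<in> sigma_sets (C \<rightarrow>\<^sub>E UNIV) ?A" for B
    using that by induction (use \<eta> in auto)
  ultimately have "\<eta> \<in> f -` {f \<eta>} \<inter> (C \<rightarrow>\<^sub>E UNIV) \<longleftrightarrow> \<xi> \<in> f -` {f \<eta>} \<inter> (C \<rightarrow>\<^sub>E UNIV)"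
    by blast
  then show ?thesis using \<eta> by auto
qed

lemma measurable_coord_algebra:
  fixes f :: "('d::finite site \<Rightarrow> nat) \<Rightarrow> real"
  assumes f: "f \<in> borel_measurable (coord_algebra C G)" and G: "G \<subseteq> C"
  shows "f \<in> borel_measurable (nu g \<rho> C)"
proof -
  have "{\<eta> \<in> C \<rightarrow>\<^sub>E UNIV. \<eta> x \<in> A} \<in> sets (nu g \<rho> C)" if "x \<in> G" for x A
  proof -
    have x: "x \<in> C" using G that by auto
    have "(\<lambda>\<eta>. \<eta> x) -` A \<inter> space (nu g \<rho> C) \<in> sets (nu g \<rho> C)"
      unfolding nu_def nu_bar_def
      using measurable_component_singleton[OF x, of "\<lambda>_. measure_pmf (marginal g (phi_of g \<rho>))"]
      by (rule measurable_sets) simp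
    moreover have "(\<lambda>\<eta>. \<eta> x) -` A \<inter> space (nu g \<rho> C) = {\<eta> \<in> C \<rightarrow>\<^sub>E UNIV. \<eta> x \<in> A}"
      by (auto simp: nu_def space_nu_bar)
    ultimately show ?thesis by simp
  qed
  then have sub: "sets (coord_algebra C G) \<subseteq> sets (nu g \<rho> C)"
    unfolding sets_coord_algebra
    by (intro sets.sigma_sets_subset'[of _ "nu g \<rho> C", unfolded nu_def space_nu_bar, folded nu_def])
      (auto intro: sets.top[of "nu g \<rho> C", unfolded nu_def space_nu_bar, folded nu_def])
  have "id \<in> measurable (nu g \<rho> C) (coord_algebra C G)"
    using sub by (intro measurableI)
      (auto simp: space_coord_algebra nu_def space_nu_bar subset_iff dest: sets.sets_into_space)
  from measurable_compose[OF this f] show ?thesis by (simp add: comp_def)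
qed


section \<open>Lattice geometry and black clusters\<close>

lemma finite_int_interval: "finite {k::int. \<bar>of_int k - c\<bar> \<le> (s::real)}"
  and card_int_interval: "s \<ge> 0 \<Longrightarrow> real (card {k::int. \<bar>of_int k - c\<bar> \<le> (s::real)}) \<le> 2 * s + 1"
proof -
  have eq: "{k::int. \<bar>of_int k - c\<bar> \<le> s} = {\<lceil>c - s\<rceil>..\<lfloor>c + s\<rfloor>}"
    by (auto simp: ceiling_le_iff le_floor_iff abs_le_iff)
  show "finite {k::int. \<bar>of_int k - c\<bar> \<le> s}" unfolding eq by simp
  assume "s \<ge> 0"
  then show "real (card {k::int. \<bar>of_int k - c\<bar> \<le> s}) \<le> 2 * s + 1"
  proof (cases "\<lfloor>c + s\<rfloor> + 1 - \<lceil>c - s\<rceil> \<ge> 0")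
    case True
    then show ?thesis unfolding eq by simp linarith
  next
    case False
    then show ?thesis using \<open>s \<ge> 0\<close> unfolding eq by simp
  qed
qed

lemma card_le_of_inj_on:
  assumes "finite B" "inj_on h A" "h ` A \<subseteq> B"
  shows "finite A \<and> card A \<le> card B"
  using assms card_inj_on_le finite_subset finite_imageD by metis

text \<open>The coordinate map h is kept general because this is applied both to sites and to pairs
  of sites, whose coordinates are pairs of integers.\<close>

lemma card_coordwise:
  fixes h :: "'a \<Rightarrow> 'd::finite \<Rightarrow> 'b"
  assumes "inj h" "\<And>i. finite (S i)"
  shows "finite {x. \<forall>i. h x i \<in> S i} \<and> card {x. \<forall>i. h x i \<in> S i} \<le> (\<Prod>i\<in>UNIV. card (S i))"
proof -
  have "finite {x. \<forall>i. h x i \<in> S i} \<and> card {x. \<forall>i. h x i \<in> S i} \<le> card (PiE UNIV S)"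
    using assms by (intro card_le_of_inj_on[where h = h]) (auto intro: finite_PiE inj_on_subset)
  then show ?thesis by (simp add: card_PiE)
qed

lemma finite_lbox [simp]: "finite (lbox x r)"
  and card_lbox: "r \<ge> 0 \<Longrightarrow> real (card (lbox (x :: 'd::finite site) r)) \<le> (2 * r + 1) ^ CARD('d)"
proof -
  let ?S = "\<lambda>i. {k::int. \<bar>of_int k - real_of_int (x $ i)\<bar> \<le> r}"
  have eq: "lbox x r = {y. \<forall>i. y $ i \<in> ?S i}" by (simp add: lbox_def)
  have *: "finite (lbox x r) \<and> card (lbox x r) \<le> (\<Prod>i\<in>UNIV. card (?S i))"
    unfolding eq by (rule card_coordwise[of "\<lambda>y i. y $ i"])
      (auto simp: inj_def vec_eq_iff fun_eq_iff finite_int_interval)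
  then show "finite (lbox x r)" by blast
  assume r: "r \<ge> 0"
  have "real (card (lbox x r)) \<le> (\<Prod>i\<in>(UNIV::'d set). real (card (?S i)))"
    using * by (simp flip: of_nat_prod)
  also have "\<dots> \<le> (\<Prod>i\<in>(UNIV::'d set). 2 * r + 1)"
    using r by (intro prod_mono) (auto intro: card_int_interval)
  finally show "real (card (lbox x r)) \<le> (2 * r + 1) ^ CARD('d)" by simp
qed

lemma lbox_sym: "x \<in> lbox y r \<longleftrightarrow> y \<in> lbox x r"
  by (simp add: lbox_def abs_minus_commute)

lemma mem_mblock:
  "x \<in> mblock K a r \<longleftrightarrow> (\<forall>i. \<bar>real_of_int (x $ i) - (2 * real K + 1) * real_of_int (a $ i)\<bar> \<le> r)"
  by (simp add: mblock_def lbox_def)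

lemma finite_mblock [simp]: "finite (mblock K a r)"
  and card_mblock: "r \<ge> 0 \<Longrightarrow> real (card (mblock K (a :: 'd::finite site) r)) \<le> (2 * r + 1) ^ CARD('d)"
  unfolding mblock_def using card_lbox by auto

text \<open>Boxes are symmetric: scaled by 2K + 1, which is injective, these centres lie in the box
  of radius r around p.\<close>

lemma card_mblock_centres:
  assumes "r \<ge> 0"
  shows "finite {w. p \<in> mblock K w r}"
    and "real (card {w :: 'd::finite site. p \<in> mblock K w r}) \<le> (2 * r + 1) ^ CARD('d)"
proof -
  let ?h = "\<lambda>w :: 'd site. (\<chi> i. (2 * int K + 1) * w $ i) :: 'd site"
  have "inj ?h"
    by (auto simp: inj_def vec_eq_iff)
  moreover have "?h ` {w. p \<in> mblock K w r} \<subseteq> lbox p r"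
    by (auto simp: mblock_def lbox_sym[of p])
  ultimately have "finite {w. p \<in> mblock K w r} \<and> card {w. p \<in> mblock K w r} \<le> card (lbox p r)"
    by (intro card_le_of_inj_on[where h = ?h]) (auto intro: inj_on_subset)
  then show "finite {w. p \<in> mblock K w r}" "real (card {w. p \<in> mblock K w r}) \<le> (2 * r + 1) ^ CARD('d)"
    using card_lbox[OF assms, of p] by auto
qed

text \<open>Blocks of radius K tile the lattice. Coordinate by coordinate, the block index is the
  quotient of x + K by 2K + 1, which settles both existence and uniqueness for the definite
  description.\<close>

lemma macro_site_mblock: "x \<in> mblock K (macro_site K x) (real K)"
proof -
  have iff: "\<bar>y - (2 * int K + 1) * c\<bar> \<le> int K \<longleftrightarrow> c = (y + int K) div (2 * int K + 1)" for y c :: int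
  proof
    assume *: "\<bar>y - (2 * int K + 1) * c\<bar> \<le> int K"
    show "c = (y + int K) div (2 * int K + 1)"
      by (rule int_div_pos_eq[symmetric, where r = "y + int K - (2 * int K + 1) * c"]) (use * in auto)
  next
    assume *: "c = (y + int K) div (2 * int K + 1)"
    have "0 \<le> (y + int K) mod (2 * int K + 1)" "(y + int K) mod (2 * int K + 1) < 2 * int K + 1"
      by (intro pos_mod_sign pos_mod_bound; simp)+
    moreover have "(2 * int K + 1) * c + (y + int K) mod (2 * int K + 1) = y + int K"
      unfolding * by simp
    ultimately show "\<bar>y - (2 * int K + 1) * c\<bar> \<le> int K" by linarith
  qed
  have "x \<in> mblock K a (real K) \<longleftrightarrow> a = (\<chi> i. (x $ i + int K) div (2 * int K + 1))" for a
  proof -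
    have "x \<in> mblock K a (real K) \<longleftrightarrow> (\<forall>i. \<bar>x $ i - (2 * int K + 1) * a $ i\<bar> \<le> int K)"
    proof -
      have "\<bar>real_of_int (x $ i) - (2 * real K + 1) * real_of_int (a $ i)\<bar> =
          real_of_int \<bar>x $ i - (2 * int K + 1) * a $ i\<bar>" for i
        by simp
      then have "\<bar>real_of_int (x $ i) - (2 * real K + 1) * real_of_int (a $ i)\<bar> \<le> real K \<longleftrightarrow>
          \<bar>x $ i - (2 * int K + 1) * a $ i\<bar> \<le> int K" for i
        by (metis of_int_le_iff of_int_of_nat_eq)
      then show ?thesis unfolding mem_mblock by blast
    qed
    then show ?thesis unfolding iff by (simp add: vec_eq_iff)
  qed
  then show ?thesis unfolding macro_site_def by (intro theI'[of "\<lambda>a. x \<in> mblock K a (real K)"]) simp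
qed

lemma macro_site_centre: "\<bar>x $ i - (2 * int K + 1) * macro_site K x $ i\<bar> \<le> int K"
proof -
  have "\<bar>real_of_int (x $ i) - (2 * real K + 1) * real_of_int (macro_site K x $ i)\<bar> \<le> real K"
    using macro_site_mblock[of x K] by (simp add: mem_mblock)
  then have "\<bar>real_of_int (x $ i - (2 * int K + 1) * macro_site K x $ i)\<bar> \<le> real_of_int (int K)"
    by simp
  then show ?thesis by linarith
qed

text \<open>The centres are at most 2K further apart than the points, which is less than one spacing
  2K + 1. The contraction by the spacing is given away, since only linear growth matters.\<close>

lemma macro_site_lipschitz: "\<bar>macro_site K x $ i - macro_site K y $ i\<bar> \<le> \<bar>x $ i - y $ i\<bar>"
proof (rule ccontr)
  let ?D = "macro_site K x $ i - macro_site K y $ i"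
  assume "\<not> \<bar>?D\<bar> \<le> \<bar>x $ i - y $ i\<bar>"
  then have "(2 * int K + 1) * (\<bar>x $ i - y $ i\<bar> + 1) \<le> (2 * int K + 1) * \<bar>?D\<bar>"
    by (intro mult_left_mono) auto
  moreover have "(2 * int K + 1) * \<bar>?D\<bar> \<le> \<bar>x $ i - y $ i\<bar> + 2 * int K"
  proof -
    have "(2 * int K + 1) * \<bar>?D\<bar> = \<bar>(2 * int K + 1) * macro_site K x $ i - (2 * int K + 1) * macro_site K y $ i\<bar>"
      by (simp add: abs_mult flip: right_diff_distrib)
    then show ?thesis using macro_site_centre[of x i K] macro_site_centre[of y i K] by linarith
  qed
  moreover have "\<bar>x $ i - y $ i\<bar> + 2 * int K + 1 \<le> (2 * int K + 1) * (\<bar>x $ i - y $ i\<bar> + 1)"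
    by (simp add: algebra_simps)
  ultimately show False by linarith
qed

text \<open>On the leg that adjusts coordinate i all other coordinates are frozen, so each of the d
  legs is a one-dimensional segment.\<close>

lemma card_coord_path:
  fixes a b :: "'d::{finite,linorder} site"
  shows "finite (coord_path a b)"
    and "(\<And>i. real_of_int \<bar>a $ i - b $ i\<bar> \<le> R) \<Longrightarrow> real (card (coord_path a b)) \<le> real CARD('d) * (R + 1)"
proof -
  let ?P = "\<lambda>i. {c :: 'd site. (\<forall>j<i. c $ j = b $ j) \<and> (\<forall>j>i. c $ j = a $ j) \<and>
              min (a $ i) (b $ i) \<le> c $ i \<and> c $ i \<le> max (a $ i) (b $ i)}"
  let ?S = "\<lambda>i j. if j < i then {b $ j} else if i < j then {a $ j} else {min (a $ i) (b $ i)..max (a $ i) (b $ i)}"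
  have P: "finite (?P i) \<and> card (?P i) \<le> card {min (a $ i) (b $ i)..max (a $ i) (b $ i)}" for i
  proof -
    have sub: "?P i \<subseteq> {c. \<forall>j. c $ j \<in> ?S i j}"
    proof (intro subsetI CollectI allI)
      fix c j assume c: "c \<in> ?P i"
      then show "c $ j \<in> ?S i j" by (cases rule: linorder_cases[of j i]) auto
    qed
    have "finite {c. \<forall>j. c $ j \<in> ?S i j} \<and> card {c. \<forall>j. c $ j \<in> ?S i j} \<le> (\<Prod>j\<in>UNIV. card (?S i j))"
      by (rule card_coordwise[of "\<lambda>(y :: 'd site) i. y $ i"]) (auto simp: inj_def vec_eq_iff fun_eq_iff)
    then have "finite (?P i) \<and> card (?P i) \<le> (\<Prod>j\<in>UNIV. card (?S i j))"
      using card_mono[OF _ sub] finite_subset[OF sub] by linarith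
    moreover have "(\<Prod>j\<in>UNIV. card (?S i j)) =
        (\<Prod>j\<in>UNIV. if j = i then card {min (a $ i) (b $ i)..max (a $ i) (b $ i)} else 1)"
      by (intro prod.cong) auto
    ultimately show ?thesis by simp
  qed
  have eq: "coord_path a b = (\<Union>i. ?P i)" by (simp add: coord_path_def)
  have "finite (?P i)" for i using P[of i] by (rule conjunct1)
  then show "finite (coord_path a b)" unfolding eq by (intro finite_UN_I) simp_all
  assume R: "\<And>i. real_of_int \<bar>a $ i - b $ i\<bar> \<le> R"
  have "card (coord_path a b) \<le> (\<Sum>i\<in>UNIV. card (?P i))"
    unfolding eq by (intro card_UN_le) simp
  then have "real (card (coord_path a b)) \<le> (\<Sum>i\<in>UNIV. real (card (?P i)))"
    by (simp flip: of_nat_sum)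
  also have "\<dots> \<le> (\<Sum>i\<in>(UNIV::'d set). R + 1)"
  proof (intro sum_mono)
    fix i :: 'd
    have "real (card (?P i)) \<le> real (card {min (a $ i) (b $ i)..max (a $ i) (b $ i)})"
      using conjunct2[OF P[of i]] by (rule of_nat_mono)
    also have "\<dots> \<le> R + 1" using R[of i] by (auto simp: min_def max_def)
    finally show "real (card (?P i)) \<le> R + 1" .
  qed
  finally show "real (card (coord_path a b)) \<le> real CARD('d) * (R + 1)" by simp
qed

text \<open>The change of variables (s, s - t) decouples the two constraints.\<close>

lemma card_near_pairs:
  assumes "p \<ge> 0" "R \<ge> 0"
  shows "finite {(s::int, t::int). \<bar>of_int s - c\<bar> \<le> (p::real) \<and> real_of_int \<bar>s - t\<bar> \<le> R}"
    and "real (card {(s::int, t::int). \<bar>of_int s - c\<bar> \<le> (p::real) \<and> real_of_int \<bar>s - t\<bar> \<le> R}) \<le> (2 * p + 1) * (2 * R + 1)"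
proof -
  let ?A = "{(s::int, t::int). \<bar>of_int s - c\<bar> \<le> p \<and> real_of_int \<bar>s - t\<bar> \<le> R}"
  let ?B = "{k::int. \<bar>of_int k - c\<bar> \<le> p} \<times> {k::int. \<bar>of_int k - 0\<bar> \<le> R}"
  have *: "finite ?A \<and> card ?A \<le> card ?B"
    by (rule card_le_of_inj_on[where h = "\<lambda>(s, t). (s, s - t)"])
      (auto simp: inj_on_def finite_int_interval intro!: finite_cartesian_product
        intro: finite_int_interval[of 0, simplified])
  then show "finite ?A" by blast
  have "real (card ?A) \<le> real (card {k::int. \<bar>of_int k - c\<bar> \<le> p}) * real (card {k::int. \<bar>of_int k - 0\<bar> \<le> R})"
    using * by (simp add: card_cartesian_product flip: of_nat_mult)
  also have "\<dots> \<le> (2 * p + 1) * (2 * R + 1)"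
    using assms by (intro mult_mono card_int_interval) auto
  finally show "real (card ?A) \<le> (2 * p + 1) * (2 * R + 1)" .
qed

text \<open>
  If \<open>a\<close> is visited while coordinate \<open>i\<close> is adjusted, then \<open>v\<^sub>j\<close> for \<open>j < i\<close>, \<open>u\<^sub>j\<close> for \<open>j > i\<close>
  are known up to \<open>K\<close>, so that only \<open>d + 1\<close> of the \<open>2d\<close> coordinates are free.
\<close>

lemma card_pairs_through:
  fixes a :: "'d::{finite,linorder} site" and K :: nat
  assumes r: "r \<ge> 1"
  defines "T \<equiv> {(u, v). (\<forall>j. real_of_int \<bar>u $ j - v $ j\<bar> \<le> 4 * r) \<and> a \<in> macro_path K u v}"
  shows "finite T"
    and "real (card T) \<le> real CARD('d) * (9 * (2 * real K + 9)) ^ CARD('d) * r ^ (CARD('d) + 1)"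
proof -
  define N where "N p c = {(s::int, t::int). \<bar>of_int s - c\<bar> \<le> (p::real) \<and> real_of_int \<bar>s - t\<bar> \<le> 4 * r}" for p c
  have finN: "finite (N p c)" if "p \<ge> 0" for p c
    unfolding N_def using that r by (intro card_near_pairs) auto
  have cardN: "real (card (N p c)) \<le> (2 * p + 1) * (9 * r)" if "p \<ge> 0" for p c
  proof -
    have "real (card (N p c)) \<le> (2 * p + 1) * (2 * (4 * r) + 1)"
      unfolding N_def using that r by (intro card_near_pairs) auto
    also have "\<dots> \<le> (2 * p + 1) * (9 * r)" using that r by (intro mult_left_mono) auto
    finally show ?thesis .
  qed
  let ?c = "\<lambda>j. (2 * real K + 1) * real_of_int (a $ j)"
  \<comment> \<open>For j < i the coordinate tied to a is that of v, hence the swap. In coordinate i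
    itself only the weaker distance 4r + K is available.\<close>
  define S where "S i j = (if j < i then prod.swap ` N K (?c j) else if i < j then N K (?c j)
     else N (4 * r + K) (?c j))" for i j
  have finS: "finite (S i j)" for i j using r by (simp add: S_def finN)
  let ?Q = "\<lambda>i. {uv :: 'd site \<times> 'd site. \<forall>j. (fst uv $ j, snd uv $ j) \<in> S i j}"
  have Q: "finite (?Q i) \<and> card (?Q i) \<le> (\<Prod>j\<in>UNIV. card (S i j))" for i
    by (rule card_coordwise[of "\<lambda>uv j. (fst uv $ j, snd uv $ j)"])
      (auto simp: inj_def vec_eq_iff fun_eq_iff finS)
  have T: "T \<subseteq> (\<Union>i. ?Q i)"
  proof (rule subsetI)
    fix uv assume "uv \<in> T"
    then obtain u v where uv: "uv = (u, v)" and d: "\<forall>j. real_of_int \<bar>u $ j - v $ j\<bar> \<le> 4 * r"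
      and "a \<in> macro_path K u v"
      by (auto simp: T_def)
    then obtain i where i: "\<And>j. j < i \<Longrightarrow> a $ j = macro_site K v $ j"
      "\<And>j. j > i \<Longrightarrow> a $ j = macro_site K u $ j"
      "min (macro_site K u $ i) (macro_site K v $ i) \<le> a $ i"
      "a $ i \<le> max (macro_site K u $ i) (macro_site K v $ i)"
      by (auto simp: macro_path_def coord_path_def)
    have b: "\<bar>of_int (x $ j) - (2 * real K + 1) * real_of_int (macro_site K x $ j)\<bar> \<le> real K" for x :: "'d site" and j
      using macro_site_mblock[of x K] by (simp add: mem_mblock)
    have "(u $ j, v $ j) \<in> S i j" for j
    proof (rule linorder_cases[of j i])
      assume "j < i"
      then show ?thesis
        using b[of v j] i(1)[of j] d by (auto simp: S_def N_def abs_minus_commute image_iff)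
    next
      assume "i < j"
      then show ?thesis using b[of u j] i(2)[of j] d by (auto simp: S_def N_def)
    next
      assume j: "j = i"
      define m where "m = 2 * real K + 1"
      have m: "m * real_of_int k \<le> m * real_of_int k'" if "k \<le> k'" for k k' :: int
        using that by (intro mult_left_mono) (auto simp: m_def)
      \<comment> \<open>The scaled coordinate of a lies between the centres belonging to u and to v.
        The first is within K of u, the second within 4r + K, so everything in between is within 4r
        + K as well.\<close>
      have "\<bar>of_int (u $ i) - m * real_of_int (a $ i)\<bar> \<le> 4 * r + K"
        using i(3,4) b[of u i] b[of v i] d[rule_format, of i]
          m[of "a $ i" "macro_site K u $ i"] m[of "macro_site K u $ i" "a $ i"]
          m[of "a $ i" "macro_site K v $ i"] m[of "macro_site K v $ i" "a $ i"]
        unfolding m_def[symmetric] by (auto simp: min_def max_def split: if_splits)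
      then show ?thesis using d j by (auto simp: S_def N_def m_def)
    qed
    then show "uv \<in> (\<Union>i. ?Q i)" unfolding uv by auto
  qed
  have "finite (?Q i)" for i using Q[of i] by (rule conjunct1)
  then have finU: "finite (\<Union>i. ?Q i)" by (intro finite_UN_I) simp_all
  show "finite T" by (rule finite_subset[OF T finU])
  \<comment> \<open>One coordinate contributes at most (2K + 1) 9r, and the exceptional one at most
    (8r + 2K + 1) 9r. With r \<ge> 1 these are bounded by M and M r, so the extra factor r occurs
    only once and the exponent of r is d + 1.\<close>
  let ?M = "9 * r * (2 * real K + 9)"
  have "card T \<le> (\<Sum>i\<in>UNIV. card (?Q i))"
    using card_mono[OF finU T] card_UN_le[of "UNIV :: 'd set" ?Q] by simp
  then have "real (card T) \<le> (\<Sum>i\<in>UNIV. real (card (?Q i)))"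
    by (simp flip: of_nat_sum)
  also have "\<dots> \<le> (\<Sum>i\<in>(UNIV :: 'd set). ?M ^ CARD('d) * r)"
  proof (intro sum_mono)
    fix i :: 'd
    have "real (card (?Q i)) \<le> (\<Prod>j\<in>UNIV. real (card (S i j)))"
      using Q by (simp flip: of_nat_prod)
    also have "\<dots> \<le> (\<Prod>j\<in>UNIV. ?M * (if j = i then r else 1))"
    proof (intro prod_mono conjI)
      fix j
      show "real (card (S i j)) \<le> ?M * (if j = i then r else 1)"
      proof (cases "j = i")
        case True
        have "real (card (S i j)) \<le> (2 * (4 * r + K) + 1) * (9 * r)"
          using True r cardN[of "4 * r + K"] by (simp add: S_def)
        also have "\<dots> \<le> ((2 * real K + 9) * r) * (9 * r)"
        proof (rule mult_right_mono)
          have "2 * real K \<le> 2 * (r * real K)" using mult_right_mono[OF r, of "real K"] by simp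
          then show "2 * (4 * r + real K) + 1 \<le> (2 * real K + 9) * r"
            using r unfolding distrib_left distrib_right mult.assoc mult.commute[of "real K" r] by linarith
        qed (use r in simp)
        finally show ?thesis using True by (simp add: mult_ac)
      next
        case False
        have "real (card (S i j)) \<le> real (card (N K (?c j)))"
          using False card_image_le[OF finN[of "real K" "?c j"], of prod.swap] by (auto simp: S_def)
        also have "\<dots> \<le> (2 * real K + 1) * (9 * r)" by (rule cardN) simp
        also have "\<dots> \<le> (2 * real K + 9) * (9 * r)" using r by (intro mult_right_mono) auto
        finally show ?thesis using False by (simp add: mult_ac)
      qed
    qed simp
    also have "\<dots> = ?M ^ CARD('d) * r" by (simp add: prod.distrib)
    finally show "real (card (?Q i)) \<le> ?M ^ CARD('d) * r" .
  qed
  also have "\<dots> = real CARD('d) * (9 * (2 * real K + 9)) ^ CARD('d) * r ^ (CARD('d) + 1)"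
    by (simp add: power_mult_distrib mult_ac)
  finally show "real (card T) \<le> real CARD('d) * (9 * (2 * real K + 9)) ^ CARD('d) * r ^ (CARD('d) + 1)" .
qed

section \<open>Neighbours, black clusters and hulls\<close>

text \<open>An integer vector with absolute entries summing to one has a single nonzero entry, 1 or
  -1. This passes from unordered bonds to the oriented steps that index the Dirichlet form.\<close>

lemma bond_diff_unit_step:
  fixes x y :: "'d::finite site"
  assumes "{x, y} \<in> bonds"
  shows "y - x \<in> unit_steps"
proof -
  have sym: "nn_adj x y \<longleftrightarrow> nn_adj y x" for x y :: "'d site"
    by (simp add: nn_adj_def abs_minus_commute)
  obtain x' y' where "{x, y} = {x', y'}" "nn_adj x' y'"
    using assms unfolding bonds_def by blast
  then have "nn_adj y x"
    using sym[of x y] by (auto simp: doubleton_eq_iff)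
  then have s: "(\<Sum>i\<in>UNIV. \<bar>(y - x) $ i\<bar>) = 1" by (simp add: nn_adj_def)
  have "\<exists>i. (y - x) $ i \<noteq> 0"
  proof (rule ccontr)
    assume "\<nexists>i. (y - x) $ i \<noteq> 0"
    then have "\<And>i. (y - x) $ i = 0" by blast
    then show False using s by (simp only: abs_zero sum.neutral_const)
  qed
  then obtain i where i: "(y - x) $ i \<noteq> 0" by blast
  have "(\<Sum>i\<in>UNIV. \<bar>(y - x) $ i\<bar>) = \<bar>(y - x) $ i\<bar> + (\<Sum>j\<in>UNIV - {i}. \<bar>(y - x) $ j\<bar>)"
    by (simp add: sum.remove)
  moreover have "(\<Sum>j\<in>UNIV - {i}. \<bar>(y - x) $ j\<bar>) \<ge> 0" by (intro sum_nonneg) simp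
  ultimately have a: "\<bar>(y - x) $ i\<bar> = 1" and "(\<Sum>j\<in>UNIV - {i}. \<bar>(y - x) $ j\<bar>) = 0"
    using s i by linarith+
  then have "\<And>j. j \<noteq> i \<Longrightarrow> (y - x) $ j = 0"
    by (subst (asm) sum_nonneg_eq_0_iff) auto
  then have "y - x = axis i ((y - x) $ i)"
    by (auto simp: vec_eq_iff axis_def)
  moreover have "(y - x) $ i \<in> {1, -1}" using a by auto
  ultimately show ?thesis unfolding unit_steps_def by blast
qed

lemma finite_unit_steps [simp]: "finite (unit_steps :: 'd::finite site set)"
  and card_unit_steps: "card (unit_steps :: 'd::finite site set) \<le> 2 * CARD('d)"
proof -
  have eq: "(unit_steps :: 'd site set) = (\<lambda>(i, s). axis i s) ` (UNIV \<times> {1, -1})"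
    by (auto simp: unit_steps_def)
  show "finite (unit_steps :: 'd site set)" unfolding eq by simp
  have "card (unit_steps :: 'd site set) \<le> card ((UNIV :: 'd set) \<times> {1, -1 :: int})"
    unfolding eq by (rule card_image_le) simp
  then show "card (unit_steps :: 'd site set) \<le> 2 * CARD('d)" by (simp add: card_cartesian_product)
qed

lemma unit_step_coord: "e \<in> unit_steps \<Longrightarrow> \<bar>e $ i\<bar> \<le> 1"
  by (auto simp: unit_steps_def axis_def)

lemma card_neighbours:
  shows "finite {y. {x, y} \<in> bonds}" and "card {y. {x, y} \<in> (bonds :: 'd::finite bond set)} \<le> 2 * CARD('d)"
proof -
  have "inj_on (\<lambda>y. y - x) A" for A by (auto simp: inj_on_def)
  then have "finite {y. {x, y} \<in> bonds} \<and> card {y. {x, y} \<in> bonds} \<le> card (unit_steps :: 'd site set)"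
    by (intro card_le_of_inj_on[where h = "\<lambda>y. y - x"]) (auto dest: bond_diff_unit_step)
  then show "finite {y. {x, y} \<in> bonds}" "card {y. {x, y} \<in> (bonds :: 'd::finite bond set)} \<le> 2 * CARD('d)"
    using card_unit_steps[where 'd = 'd] by auto
qed

text \<open>Since \<open>star_adj\<close> is symmetric, clusters partition the black sites; hence
  being bad is a property of the whole cluster.\<close>

lemma black_cluster_sym: "b \<in> black_cluster s a \<Longrightarrow> a \<in> black_cluster s b"
  and black_cluster_eq: "b \<in> black_cluster s a \<Longrightarrow> black_cluster s b = black_cluster s a"
proof -
  let ?R = "\<lambda>x y. \<not> s x \<and> \<not> s y \<and> star_adj x y"
  have "symp ?R"
    by (intro sympI) (auto simp: star_adj_def sup_norm_def abs_minus_commute)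
  then have sym: "?R\<^sup>*\<^sup>* y x" if "?R\<^sup>*\<^sup>* x y" for x y
    using that by (rule sympD[OF symp_rtranclp])
  assume b: "b \<in> black_cluster s a"
  then have a: "\<not> s a" "?R\<^sup>*\<^sup>* a b"
    unfolding black_cluster_def site_cluster_def by (simp_all split: if_splits)
  have sb: "\<not> s b" using a(2,1) by induction auto
  show "a \<in> black_cluster s b"
    using sym[OF a(2)] sb by (simp add: black_cluster_def site_cluster_def)
  show "black_cluster s b = black_cluster s a"
  proof -
    have "?R\<^sup>*\<^sup>* b = ?R\<^sup>*\<^sup>* a"
    proof
      fix c
      show "?R\<^sup>*\<^sup>* b c = ?R\<^sup>*\<^sup>* a c"
        using rtranclp_trans[OF a(2), of c] rtranclp_trans[OF sym[OF a(2)], of c] by (rule iffI)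
    qed
    then show ?thesis using a(1) sb by (simp add: black_cluster_def site_cluster_def)
  qed
qed

lemma good_site_cluster:
  assumes "L > 0" "a \<notin> bad_sites s L"
  shows "finite (black_cluster s a)" "real (card (black_cluster s a)) \<le> L"
proof -
  have le: "esize (black_cluster s a) \<le> ennreal L" using assms by (simp add: bad_sites_def)
  show "finite (black_cluster s a)"
    using le by (rule_tac ccontr) (simp add: esize_def top_unique)
  then show "real (card (black_cluster s a)) \<le> L"
    using le assms by (simp add: esize_def ennreal_of_nat_eq_real_of_nat)
qed

text \<open>The 1 accounts for the site itself, L for its cluster and 2dL for the outer boundary.
  The same number serves for the dual count, of the sites whose hull contains a given w.\<close>

definition hull_bound :: "'d itself \<Rightarrow> real \<Rightarrow> real" where
  "hull_bound _ L = 1 + (2 * real CARD('d) + 1) * L"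

lemma card_black_hull:
  fixes a :: "'d::finite site"
  assumes "L > 0" "a \<notin> bad_sites s L"
  shows "finite (black_hull s a)" "real (card (black_hull s a)) \<le> hull_bound TYPE('d) L"
proof -
  let ?C = "black_cluster s a"
  note C = good_site_cluster[OF assms]
  have sub: "black_hull s a \<subseteq> {a} \<union> ?C \<union> (\<Union>y\<in>?C. {x. {y, x} \<in> bonds})"
    by (auto simp: black_hull_def outer_boundary_def insert_commute)
  have fin: "finite ({a} \<union> ?C \<union> (\<Union>y\<in>?C. {x. {y, x} \<in> bonds}))"
    using C card_neighbours by auto
  then show "finite (black_hull s a)" using sub by (rule rev_finite_subset)
  have "card (\<Union>y\<in>?C. {x. {y, x} \<in> bonds}) \<le> (\<Sum>y\<in>?C. card {x. {y, x} \<in> bonds})"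
    using C by (intro card_UN_le) auto
  also have "\<dots> \<le> card ?C * (2 * CARD('d))"
    using card_neighbours(2)[where 'd = 'd] by (intro order_trans[OF sum_bounded_above]) auto
  finally have "card (\<Union>y\<in>?C. {x. {y, x} \<in> bonds}) \<le> card ?C * (2 * CARD('d))" .
  moreover have "card (black_hull s a) \<le> card {a} + card ?C + card (\<Union>y\<in>?C. {x. {y, x} \<in> bonds})"
    using card_mono[OF fin sub] card_Un_le[of "{a} \<union> ?C" "\<Union>y\<in>?C. {x. {y, x} \<in> bonds}"] card_Un_le[of "{a}" ?C] by linarith
  ultimately have "card (black_hull s a) \<le> 1 + card ?C * (2 * CARD('d) + 1)" by simp
  then have "real (card (black_hull s a)) \<le> real (1 + card ?C * (2 * CARD('d) + 1))"
    by (rule of_nat_mono)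
  also have "\<dots> = 1 + real (card ?C) * (2 * real CARD('d) + 1)"
    by (simp add: distrib_left)
  also have "\<dots> \<le> 1 + L * (2 * real CARD('d) + 1)"
    using C by (intro add_left_mono mult_right_mono) auto
  finally show "real (card (black_hull s a)) \<le> hull_bound TYPE('d) L"
    by (simp add: hull_bound_def mult.commute)
qed

text \<open>If w lies in the hull of a, then a = w, or the cluster of a contains w or one of its at
  most 2d neighbours. Call that site b: by symmetry a belongs to the cluster of b, which has size at
  most L.\<close>

lemma card_hull_column:
  fixes w :: "'d::finite site"
  assumes L: "L > 0"
  shows "finite {a. a \<notin> bad_sites s L \<and> w \<in> black_hull s a}"
    and "real (card {a. a \<notin> bad_sites s L \<and> w \<in> black_hull s a}) \<le> hull_bound TYPE('d) L"
proof -
  let ?A = "{a. a \<notin> bad_sites s L \<and> w \<in> black_hull s a}"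
  let ?N = "insert w {y. {w, y} \<in> bonds}"
  let ?B = "\<lambda>b. if b \<in> bad_sites s L then {} else black_cluster s b"
  have bad: "b \<notin> bad_sites s L" if "b \<in> black_cluster s a" "a \<notin> bad_sites s L" for a b
    using black_cluster_eq[OF that(1)] that(2) by (simp add: bad_sites_def)
  have sub: "?A \<subseteq> {w} \<union> (\<Union>b\<in>?N. ?B b)"
  proof
    fix a assume a: "a \<in> ?A"
    show "a \<in> {w} \<union> (\<Union>b\<in>?N. ?B b)"
    proof (cases "s a")
      case True
      then show ?thesis using a by (auto simp: black_hull_def)
    next
      case False
      then have "w \<in> black_cluster s a \<or> (\<exists>b\<in>black_cluster s a. {w, b} \<in> bonds)"
        using a by (auto simp: black_hull_def outer_boundary_def)
      then obtain b where "b \<in> black_cluster s a" "b \<in> ?N" by auto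
      then show ?thesis using bad[of b a] black_cluster_sym[of b s a] a by auto
    qed
  qed
  have finN: "finite ?N" using card_neighbours by auto
  have B: "finite (?B b)" "real (card (?B b)) \<le> L" for b
    using good_site_cluster[OF L, of b s] L by auto
  have fin: "finite ({w} \<union> (\<Union>b\<in>?N. ?B b))" using finN B by blast
  show "finite ?A" by (rule finite_subset[OF sub fin])
  have cN: "card ?N \<le> 2 * CARD('d) + 1"
    using card_neighbours(2)[of w] card_insert_le_m1[of "2 * CARD('d) + 1" "{y. {w, y} \<in> bonds}" w] by simp
  have "card ?A \<le> 1 + (\<Sum>b\<in>?N. card (?B b))"
    using card_mono[OF fin sub] card_Un_le[of "{w}" "\<Union>b\<in>?N. ?B b"] card_UN_le[OF finN, of ?B] by simp
  then have "real (card ?A) \<le> real (1 + (\<Sum>b\<in>?N. card (?B b)))"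
    by (rule of_nat_mono)
  also have "\<dots> = 1 + (\<Sum>b\<in>?N. real (card (?B b)))"
    by (simp only: of_nat_add of_nat_1 of_nat_sum)
  also have "\<dots> \<le> 1 + real (card ?N) * L"
    using B by (intro add_left_mono sum_bounded_above)
  also have "\<dots> \<le> 1 + (2 * real CARD('d) + 1) * L"
    using cN L by (intro add_left_mono mult_right_mono) auto
  finally show "real (card ?A) \<le> hull_bound TYPE('d) L" by (simp add: hull_bound_def)
qed

text \<open>If a were bad, its whole cluster would be, and w is within distance one of some b in it.
  The block centres of w and b then differ by at most 2K + 1 per coordinate, so p is within 5K/4 +
  2K + 1 \<le> 10K of the centre of b: this is the use of the radius 10K in
  \<open>bad_region\<close>.\<close>

lemma good_point_macro:
  assumes K: "K > 0" and p: "p \<in> mblock K w (5 * real K / 4)" "p \<notin> bad_region K s L"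
    and w: "w \<in> black_hull s a"
  shows "a \<notin> bad_sites s L"
proof
  assume a: "a \<in> bad_sites s L"
  have "\<not> s a"
  proof
    assume "s a"
    then have "black_cluster s a = {}" by (simp add: black_cluster_def site_cluster_def)
    then show False using a by (simp add: bad_sites_def esize_def)
  qed
  have bad: "b \<in> bad_sites s L" if "b \<in> black_cluster s a" for b
    using black_cluster_eq[OF that] a by (simp add: bad_sites_def)
  obtain b where b: "b \<in> black_cluster s a" "b = w \<or> {w, b} \<in> bonds"
    using w \<open>\<not> s a\<close> by (auto simp: black_hull_def outer_boundary_def)
  have "p \<in> mblock K b (10 * real K)"
    unfolding mem_mblock
  proof
    fix i
    have "\<bar>(b - w) $ i\<bar> \<le> 1"
      using b(2)
    proof
      assume "{w, b} \<in> bonds"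
      then show ?thesis by (intro unit_step_coord bond_diff_unit_step)
    qed simp
    then have "\<bar>real_of_int (b $ i) - real_of_int (w $ i)\<bar> \<le> 1" by simp
    then have "(2 * real K + 1) * \<bar>real_of_int (b $ i) - real_of_int (w $ i)\<bar> \<le> (2 * real K + 1) * 1"
      by (intro mult_left_mono) auto
    then have "\<bar>(2 * real K + 1) * real_of_int (b $ i) - (2 * real K + 1) * real_of_int (w $ i)\<bar> \<le> 2 * real K + 1"
      by (simp add: abs_mult flip: right_diff_distrib)
    moreover have "\<bar>real_of_int (p $ i) - (2 * real K + 1) * real_of_int (w $ i)\<bar> \<le> 5 * real K / 4"
      using p(1) by (simp add: mem_mblock)
    moreover have "real K \<ge> 1" using K by simp
    ultimately show "\<bar>real_of_int (p $ i) - (2 * real K + 1) * real_of_int (b $ i)\<bar> \<le> 10 * real K"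
      by linarith
  qed
  then show False using p(2) bad[OF b(1)] by (auto simp: bad_region_def)
qed


section \<open>Energy along paths\<close>

text \<open>Loop erasure: if the new head already occurs further on, everything before that
  occurrence is discarded. Afterwards each vertex is charged boundedly often, however long the
  original path.\<close>

lemma exists_distinct_path:
  assumes "successively R xs" "xs \<noteq> []"
  shows "\<exists>ys. ys \<noteq> [] \<and> hd ys = hd xs \<and> last ys = last xs \<and> set ys \<subseteq> set xs \<and> successively R ys \<and> distinct ys"
  using assms
proof (induction xs)
  case (Cons x xs)
  show ?case
  proof (cases "xs = []")
    case True
    then show ?thesis by (intro exI[of _ "[x]"]) simp
  next
    case False
    then obtain ys where ys: "ys \<noteq> []" "hd ys = hd xs" "last ys = last xs" "set ys \<subseteq> set xs"
      "successively R ys" "distinct ys"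
      using Cons by (auto simp: successively_Cons)
    show ?thesis
    proof (cases "x \<in> set ys")
      case True
      then obtain as bs where ab: "ys = as @ x # bs" by (meson split_list)
      have "successively R (x # bs)"
        using ys(5) unfolding ab successively_append_iff by blast
      then show ?thesis using ys False
        by (intro exI[of _ "x # bs"]) (auto simp: ab)
    next
      case x: False
      have "R x (hd ys)" using Cons.prems False ys by (simp add: successively_Cons)
      then show ?thesis using ys x False
        by (intro exI[of _ "x # ys"]) (auto simp: successively_Cons)
    qed
  qed
qed simp

text \<open>
  Each step of a path is charged to an endpoint in \<open>G\<close>; the second sum is needed because a point
  of \<open>G\<close> can be charged for the step into it as well as for the step out of it.
\<close>

lemma path_variation:
  fixes h :: "'a \<Rightarrow> real"
  assumes h: "\<And>x. x \<notin> G \<Longrightarrow> h x = c" and fin: "\<And>x. finite (Nb x)"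
    and "successively (\<lambda>x y. y \<in> Nb x \<and> x \<in> Nb y) xs" "distinct xs" "xs \<noteq> []"
  defines "D \<equiv> \<lambda>x. \<Sum>y\<in>Nb x. \<bar>h x - h y\<bar>"
  shows "\<bar>h (hd xs) - h (last xs)\<bar> \<le> (\<Sum>x\<in>set xs \<inter> G. D x) + (\<Sum>x\<in>set (tl xs) \<inter> G. D x)"
  using assms(3-5)
proof (induction xs)
  case (Cons x xs)
  have D0: "D z \<ge> 0" for z unfolding D_def by (intro sum_nonneg) simp
  show ?case
  proof (cases xs)
    case Nil
    then show ?thesis using D0 by (simp add: sum_nonneg)
  next
    case (Cons y ys)
    note xs = this
    have st: "y \<in> Nb x" "x \<in> Nb y" using Cons.prems xs by auto
    have IH: "\<bar>h y - h (last xs)\<bar> \<le> (\<Sum>x\<in>set xs \<inter> G. D x) + (\<Sum>x\<in>set ys \<inter> G. D x)"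
      using Cons.IH Cons.prems xs by simp
    have new: "(\<Sum>x\<in>insert z A \<inter> G. D x) = (if z \<in> G then D z else 0) + (\<Sum>x\<in>A \<inter> G. D x)"
      if "z \<notin> A" "finite A" for z A
      using that by (auto simp: Int_insert_left)
    \<comment> \<open>A step with both ends outside \<open>G\<close> costs nothing, as h equals c at
      both; any other step is a summand of \<open>D\<close> at an end in \<open>G\<close>.\<close>
    have "\<bar>h x - h y\<bar> \<le> (if x \<in> G then D x else 0) + (if y \<in> G then D y else 0)"
    proof -
      have "\<bar>h x - h y\<bar> \<le> D x" unfolding D_def
        by (rule member_le_sum[OF st(1), of "\<lambda>y. \<bar>h x - h y\<bar>"]) (use fin in auto)
      moreover have "\<bar>h y - h x\<bar> \<le> D y" unfolding D_def
        by (rule member_le_sum[OF st(2), of "\<lambda>x. \<bar>h y - h x\<bar>"]) (use fin in auto)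
      ultimately show ?thesis using h[of x] h[of y] D0[of x] D0[of y]
        by (auto simp: abs_minus_commute)
    qed
    moreover have "(\<Sum>x\<in>set (x # xs) \<inter> G. D x) = (if x \<in> G then D x else 0) + (\<Sum>x\<in>set xs \<inter> G. D x)"
      using new[of x "set xs"] Cons.prems by simp
    moreover have "(\<Sum>x\<in>set (tl (x # xs)) \<inter> G. D x) = (if y \<in> G then D y else 0) + (\<Sum>x\<in>set ys \<inter> G. D x)"
      using new[of y "set ys"] Cons.prems xs by simp
    moreover have "\<bar>h x - h (last xs)\<bar> \<le> \<bar>h x - h y\<bar> + \<bar>h y - h (last xs)\<bar>" by simp
    ultimately show ?thesis using IH xs by simp
  qed
qed simp

text \<open>Cauchy-Schwarz is used twice, over the vertices of \<open>S \<inter> G\<close> and over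
  the neighbours of each. The factor 4 is the square of the two charges per vertex; the length of
  the path does not enter.\<close>

lemma path_variation_squared:
  fixes h :: "'a \<Rightarrow> real"
  assumes h: "\<And>x. x \<notin> G \<Longrightarrow> h x = c"
    and fin: "\<And>x. finite (Nb x)" and k: "\<And>x. card (Nb x) \<le> k"
    and path: "successively (\<lambda>x y. y \<in> Nb x \<and> x \<in> Nb y) xs" "xs \<noteq> []" "set xs \<subseteq> S"
    and S: "finite (S \<inter> G)" "real (card (S \<inter> G)) \<le> m"
  shows "(h (hd xs) - h (last xs))\<^sup>2 \<le> 4 * real k * m * (\<Sum>x\<in>S \<inter> G. \<Sum>y\<in>Nb x. (h x - h y)\<^sup>2)"
proof -
  define D where "D x = (\<Sum>y\<in>Nb x. \<bar>h x - h y\<bar>)" for x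
  have D0: "D z \<ge> 0" for z unfolding D_def by (intro sum_nonneg) simp
  have m0: "0 \<le> m" using S(2) by linarith
  obtain ys where ys: "ys \<noteq> []" "hd ys = hd xs" "last ys = last xs" "set ys \<subseteq> set xs"
    "successively (\<lambda>x y. y \<in> Nb x \<and> x \<in> Nb y) ys" "distinct ys"
    using exists_distinct_path[OF path(1,2)] by blast
  have mono: "(\<Sum>x\<in>set zs \<inter> G. D x) \<le> (\<Sum>x\<in>S \<inter> G. D x)" if "set zs \<subseteq> set ys" for zs
    using that ys(4) path(3) S(1) D0 by (intro sum_mono2) auto
  have "\<bar>h (hd xs) - h (last xs)\<bar> \<le> (\<Sum>x\<in>set ys \<inter> G. D x) + (\<Sum>x\<in>set (tl ys) \<inter> G. D x)"
    using path_variation[OF h fin ys(5,6,1)] ys(2,3) by (simp add: D_def)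
  also have "\<dots> \<le> 2 * (\<Sum>x\<in>S \<inter> G. D x)"
  proof -
    have "set (tl ys) \<subseteq> set ys" by (cases ys) auto
    from mono[OF order_refl] mono[OF this] show ?thesis by linarith
  qed
  finally have "(h (hd xs) - h (last xs))\<^sup>2 \<le> (2 * (\<Sum>x\<in>S \<inter> G. D x))\<^sup>2"
    by (subst (1) power2_abs[symmetric]) (rule power_mono, auto)
  then have A: "(h (hd xs) - h (last xs))\<^sup>2 \<le> 4 * (\<Sum>x\<in>S \<inter> G. D x)\<^sup>2"
    by (simp add: power_mult_distrib)
  have "(\<Sum>x\<in>S \<inter> G. D x)\<^sup>2 \<le> (\<Sum>x\<in>S \<inter> G. (D x)\<^sup>2) * real (card (S \<inter> G))"
    by (rule sum_squared_le_sum_of_squares)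
  also have "\<dots> \<le> (\<Sum>x\<in>S \<inter> G. (D x)\<^sup>2) * m"
    using S by (intro mult_left_mono sum_nonneg) auto
  also have "\<dots> \<le> (\<Sum>x\<in>S \<inter> G. real k * (\<Sum>y\<in>Nb x. (h x - h y)\<^sup>2)) * m"
  proof (intro mult_right_mono sum_mono m0)
    fix x
    have "(D x)\<^sup>2 \<le> (\<Sum>y\<in>Nb x. \<bar>h x - h y\<bar>\<^sup>2) * real (card (Nb x))"
      unfolding D_def by (rule sum_squared_le_sum_of_squares)
    also have "\<dots> \<le> (\<Sum>y\<in>Nb x. \<bar>h x - h y\<bar>\<^sup>2) * real k"
      using k[of x] by (intro mult_left_mono sum_nonneg) auto
    finally show "(D x)\<^sup>2 \<le> real k * (\<Sum>y\<in>Nb x. (h x - h y)\<^sup>2)" by (simp add: mult.commute)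
  qed
  finally have "4 * (\<Sum>x\<in>S \<inter> G. D x)\<^sup>2 \<le> 4 * real k * m * (\<Sum>x\<in>S \<inter> G. \<Sum>y\<in>Nb x. (h x - h y)\<^sup>2)"
    by (simp add: sum_distrib_left[symmetric] mult_ac)
  then show ?thesis using A by linarith
qed

text \<open>Grouped by the value of h, each \<open>F q\<close> occurs at most M times. All later
  exchanges of summation, from configurations to pairs, from pairs to macroscopic sites and from
  blocks to points, go through this bound.\<close>

lemma sum_fibre_bound:
  fixes F :: "'b \<Rightarrow> ennreal"
  assumes T: "finite T" and h: "h ` T \<subseteq> Q" "finite Q"
    and c: "\<And>q. q \<in> Q \<Longrightarrow> real (card {t \<in> T. h t = q}) \<le> M"
  shows "(\<Sum>t\<in>T. F (h t)) \<le> ennreal M * (\<Sum>q\<in>Q. F q)"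
proof -
  have "(\<Sum>t\<in>T. F (h t)) = (\<Sum>q\<in>h ` T. \<Sum>t\<in>{t \<in> T. h t = q}. F (h t))"
    by (rule sum.image_gen[OF T])
  also have "\<dots> = (\<Sum>q\<in>h ` T. of_nat (card {t \<in> T. h t = q}) * F q)"
    by simp
  also have "\<dots> \<le> (\<Sum>q\<in>h ` T. ennreal M * F q)"
    using c h by (intro sum_mono mult_right_mono)
      (auto simp: ennreal_of_nat_eq_real_of_nat intro!: ennreal_leI)
  also have "\<dots> \<le> (\<Sum>q\<in>Q. ennreal M * F q)"
    using h by (intro sum_mono2) auto
  finally show ?thesis by (simp add: sum_distrib_left)
qed

lemma card_Sigma_le:
  assumes "finite A" "\<And>x. x \<in> A \<Longrightarrow> finite (B x)" "real (card A) \<le> p"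
    "\<And>x. x \<in> A \<Longrightarrow> real (card (B x)) \<le> q" "0 \<le> q"
  shows "real (card (Sigma A B)) \<le> p * q"
proof -
  have "real (card (Sigma A B)) = (\<Sum>x\<in>A. real (card (B x)))"
    using assms by (simp add: card_SigmaI)
  also have "\<dots> \<le> real (card A) * q" using assms by (intro sum_bounded_above) auto
  also have "\<dots> \<le> p * q" using assms by (intro mult_right_mono)
  finally show ?thesis .
qed

section \<open>Comparison of gradients with the Dirichlet form\<close>

text \<open>Membership of q in \<open>clus 0 \<omega>\<close> makes the jump to q one of those in
  the Dirichlet form; the threshold \<alpha> bounds its conductance from below.\<close>

definition open_nbrs :: "real \<Rightarrow> ('d::finite bond \<Rightarrow> real) \<Rightarrow> 'd site \<Rightarrow> 'd site set" where
  "open_nbrs \<alpha> \<omega> p = {q \<in> clus 0 \<omega>. {p, q} \<in> bonds \<and> hat \<alpha> \<omega> {p, q}}"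

lemma finite_open_nbrs: "finite (open_nbrs \<alpha> \<omega> p)"
  and card_open_nbrs: "card (open_nbrs \<alpha> \<omega> (p :: 'd::finite site)) \<le> 2 * CARD('d)"
proof -
  have sub: "open_nbrs \<alpha> \<omega> p \<subseteq> {q. {p, q} \<in> bonds}" by (auto simp: open_nbrs_def)
  show "finite (open_nbrs \<alpha> \<omega> p)" using sub card_neighbours(1) by (rule finite_subset)
  show "card (open_nbrs \<alpha> \<omega> p) \<le> 2 * CARD('d)"
    using card_mono[OF card_neighbours(1) sub] card_neighbours(2) by (rule order_trans)
qed

lemma clus_antimono:
  assumes "\<alpha> \<le> \<beta>"
  shows "clus \<beta> \<omega> \<subseteq> clus \<alpha> \<omega>"
proof
  fix x assume x: "x \<in> clus \<beta> \<omega>"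
  have "bond_cluster (hat \<beta> \<omega>) x \<subseteq> bond_cluster (hat \<alpha> \<omega>) x"
  proof
    fix y assume "y \<in> bond_cluster (hat \<beta> \<omega>) x"
    then have "(\<lambda>u v. {u, v} \<in> bonds \<and> hat \<beta> \<omega> {u, v})\<^sup>*\<^sup>* x y" by (simp add: bond_cluster_def)
    then have "(\<lambda>u v. {u, v} \<in> bonds \<and> hat \<alpha> \<omega> {u, v})\<^sup>*\<^sup>* x y"
      by (rule rtranclp_mono[THEN predicate2D, rotated]) (use assms in \<open>auto simp: hat_def\<close>)
    then show "y \<in> bond_cluster (hat \<alpha> \<omega>) x" by (simp add: bond_cluster_def)
  qed
  then show "x \<in> clus \<alpha> \<omega>"
    using x finite_subset unfolding clus_def infinite_cluster_def by blast
qed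

text \<open>Each bond counted has \<omega> > \<alpha>, so inserting the factor \<omega>/\<alpha>
  only increases the sum of jump terms. The 2 undoes the halving in the Dirichlet form; the finite
  sum over S is part of the infinite one over the cluster.\<close>

lemma dirichlet_lower_bound:
  fixes \<omega> :: "'d::finite bond \<Rightarrow> real"
  assumes g: "zero_range_rate g" and r: "\<rho> > 0" and \<alpha>: "\<alpha> > 0"
    and f: "f \<in> borel_measurable (nu g \<rho> (clus 0 \<omega>))"
    and S: "finite S" "S \<subseteq> clus 0 \<omega>"
  shows "ennreal (phi_of g \<rho>) * (\<Sum>p\<in>S. \<Sum>q\<in>open_nbrs \<alpha> \<omega> p.
      \<integral>\<^sup>+\<eta>. ennreal ((grad p q (\<lambda>\<xi>. sqrt (f \<xi>)) \<eta>)\<^sup>2) \<partial>nu g \<rho> (clus 0 \<omega>))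
    \<le> ennreal (2 / \<alpha>) * dirichlet g \<rho> \<omega> f"
proof -
  let ?nu = "nu g \<rho> (clus 0 \<omega>)"
  let ?I = "\<lambda>p q. \<integral>\<^sup>+\<eta>. ennreal (g (\<eta> p) * (sqrt (f (move_particle p q \<eta>)) - sqrt (f \<eta>))\<^sup>2) \<partial>?nu"
  let ?E = "\<lambda>p. {e \<in> unit_steps. p + e \<in> clus 0 \<omega>}"
  let ?d = "\<lambda>p. \<Sum>e\<in>?E p. ennreal (\<omega> {p, p + e}) * ?I p (p + e)"
  have site: "ennreal (phi_of g \<rho>) * (\<Sum>q\<in>open_nbrs \<alpha> \<omega> p.
      \<integral>\<^sup>+\<eta>. ennreal ((grad p q (\<lambda>\<xi>. sqrt (f \<xi>)) \<eta>)\<^sup>2) \<partial>?nu) \<le> ennreal (1 / \<alpha>) * ?d p" if p: "p \<in> S" for p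
  proof -
    have "ennreal (phi_of g \<rho>) * (\<Sum>q\<in>open_nbrs \<alpha> \<omega> p.
        \<integral>\<^sup>+\<eta>. ennreal ((grad p q (\<lambda>\<xi>. sqrt (f \<xi>)) \<eta>)\<^sup>2) \<partial>?nu) = (\<Sum>q\<in>open_nbrs \<alpha> \<omega> p. ?I p q)"
      unfolding sum_distrib_left
      using p S by (intro sum.cong refl nn_integral_jump[OF g r _ _ f, symmetric])
        (auto simp: open_nbrs_def)
    also have "\<dots> \<le> (\<Sum>q\<in>open_nbrs \<alpha> \<omega> p. ennreal (1 / \<alpha>) * (ennreal (\<omega> {p, q}) * ?I p q))"
    proof (rule sum_mono)
      fix q assume "q \<in> open_nbrs \<alpha> \<omega> p"
      then have w: "\<omega> {p, q} > \<alpha>" by (simp add: open_nbrs_def hat_def)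
      have e: "ennreal (1 / \<alpha> * \<omega> {p, q}) = ennreal (1 / \<alpha>) * ennreal (\<omega> {p, q})"
        using \<alpha> by (intro ennreal_mult') simp
      have "1 * ?I p q \<le> ennreal (1 / \<alpha> * \<omega> {p, q}) * ?I p q"
        using w \<alpha> by (intro mult_right_mono) (auto simp: field_simps simp flip: ennreal_1 intro!: ennreal_leI)
      then show "?I p q \<le> ennreal (1 / \<alpha>) * (ennreal (\<omega> {p, q}) * ?I p q)"
        unfolding e mult.assoc mult_1_left .
    qed
    also have "\<dots> = (\<Sum>e\<in>(\<lambda>q. q - p) ` open_nbrs \<alpha> \<omega> p. ennreal (1 / \<alpha>) * (ennreal (\<omega> {p, p + e}) * ?I p (p + e)))"
      by (subst sum.reindex) (auto simp: inj_on_def)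
    also have "\<dots> \<le> (\<Sum>e\<in>?E p. ennreal (1 / \<alpha>) * (ennreal (\<omega> {p, p + e}) * ?I p (p + e)))"
      by (intro sum_mono2) (auto simp: open_nbrs_def bond_diff_unit_step)
    finally show ?thesis by (simp add: sum_distrib_left)
  qed
  have "ennreal (phi_of g \<rho>) * (\<Sum>p\<in>S. \<Sum>q\<in>open_nbrs \<alpha> \<omega> p.
      \<integral>\<^sup>+\<eta>. ennreal ((grad p q (\<lambda>\<xi>. sqrt (f \<xi>)) \<eta>)\<^sup>2) \<partial>?nu) \<le> (\<Sum>p\<in>S. ennreal (1 / \<alpha>) * ?d p)"
    unfolding sum_distrib_left[of _ _ S] by (intro sum_mono site)
  also have "\<dots> = ennreal (1 / \<alpha>) * (\<Sum>\<^sub>\<infinity>p\<in>S. ?d p)"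
    using S by (simp add: sum_distrib_left)
  also have "\<dots> \<le> ennreal (1 / \<alpha>) * (\<Sum>\<^sub>\<infinity>p\<in>clus 0 \<omega>. ?d p)"
    using S by (intro mult_left_mono infsum_mono_neutral nonneg_summable_on_complete) auto
  also have "(\<Sum>\<^sub>\<infinity>p\<in>clus 0 \<omega>. ?d p) = 2 * dirichlet g \<rho> \<omega> f"
  proof -
    have "2 * (X / 2) = X" for X :: ennreal
      by (simp add: ennreal_times_divide mult.commute[of 2] mult_divide_eq_ennreal)
    then show ?thesis unfolding dirichlet_def by simp
  qed
  also have "ennreal (1 / \<alpha>) * (2 * dirichlet g \<rho> \<omega> f) = ennreal (2 / \<alpha>) * dirichlet g \<rho> \<omega> f"
  proof -
    have "ennreal (2 / \<alpha>) = ennreal (1 / \<alpha>) * ennreal 2"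
      using \<alpha> by (subst ennreal_mult'[symmetric]) auto
    then show ?thesis by (simp add: mult.assoc)
  qed
  finally show ?thesis .
qed

text \<open>The path does not depend on \<eta>, so the variation estimate holds for each \<eta>
  separately and is then integrated. The constant is 4 times the degree bound 2d times m.\<close>

lemma nn_integral_grad_path:
  fixes \<omega> :: "'d::{finite,linorder} bond \<Rightarrow> real" and g :: "nat \<Rightarrow> real" and \<rho> :: real
  assumes \<alpha>: "\<alpha> > 0"
    and f: "f \<in> borel_measurable (coord_algebra (clus 0 \<omega>) G)" and G: "G \<subseteq> clus 0 \<omega>"
    and joined: "joined_within (hat \<alpha> \<omega>) (clus \<alpha> \<omega> \<inter> W) u v"
    and W: "finite (W \<inter> G)" "real (card (W \<inter> G)) \<le> m"
  defines "J \<equiv> \<lambda>p q. \<integral>\<^sup>+\<eta>. ennreal ((grad p q (\<lambda>\<xi>. sqrt (f \<xi>)) \<eta>)\<^sup>2) \<partial>nu g \<rho> (clus 0 \<omega>)"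
  shows "J u v \<le> ennreal (8 * real CARD('d) * m) * (\<Sum>p\<in>W \<inter> G. \<Sum>q\<in>open_nbrs \<alpha> \<omega> p. J p q)"
proof -
  let ?C = "clus 0 \<omega>"
  let ?nu = "nu g \<rho> ?C"
  let ?h = "\<lambda>\<xi>. sqrt (f \<xi>)"
  let ?c = "8 * real CARD('d) * m"
  have m0: "0 \<le> m" using W(2) by linarith
  have C: "clus \<alpha> \<omega> \<subseteq> ?C" using \<alpha> by (intro clus_antimono) simp
  obtain xs where xs: "xs \<noteq> []" "hd xs = u" "last xs = v" "set xs \<subseteq> clus \<alpha> \<omega> \<inter> W"
    "successively (\<lambda>x y. {x, y} \<in> bonds \<and> hat \<alpha> \<omega> {x, y}) xs"
    using joined unfolding joined_within_def by blast
  have path: "successively (\<lambda>x y. y \<in> open_nbrs \<alpha> \<omega> x \<and> x \<in> open_nbrs \<alpha> \<omega> y) xs"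
    using xs(5) by (rule successively_mono)
      (use xs(4) C in \<open>auto simp: open_nbrs_def insert_commute\<close>)
  have "hd xs \<in> set xs" "last xs \<in> set xs" using xs(1) by simp_all
  then have uv: "u \<in> ?C" "v \<in> ?C" using xs C by blast+
  have pointwise: "(grad u v ?h \<eta>)\<^sup>2 \<le> ?c * (\<Sum>p\<in>W \<inter> G. \<Sum>q\<in>open_nbrs \<alpha> \<omega> p. (grad p q ?h \<eta>)\<^sup>2)"
    if \<eta>: "\<eta> \<in> space ?nu" for \<eta>
  proof -
    have \<eta>': "\<eta> \<in> ?C \<rightarrow>\<^sub>E UNIV" using \<eta> by (simp add: nu_def space_nu_bar)
    \<comment> \<open>Off the cluster, adding a particle would leave the configuration space. The
      default is the value that h has at cluster sites outside \<open>G\<close>, so that h is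
      constant off \<open>G\<close>.\<close>
    define h where "h x = (if x \<in> ?C then ?h (add_particle x \<eta>) else ?h \<eta>)" for x
    have "h x = ?h \<eta>" if "x \<notin> G" for x
    proof (cases "x \<in> ?C")
      case True
      then have "f (add_particle x \<eta>) = f \<eta>"
        using \<eta>' that by (intro coord_algebra_eq_on[OF f]) (auto simp: add_particle_def PiE_iff extensional_def)
      then show ?thesis using True by (simp add: h_def)
    qed (simp add: h_def)
    from path_variation_squared[OF this finite_open_nbrs card_open_nbrs path xs(1) _ W] xs(2-4)
    have "(h u - h v)\<^sup>2 \<le> 4 * real (2 * CARD('d)) * m * (\<Sum>p\<in>W \<inter> G. \<Sum>q\<in>open_nbrs \<alpha> \<omega> p. (h p - h q)\<^sup>2)"
      by auto
    moreover have "(\<Sum>p\<in>W \<inter> G. \<Sum>q\<in>open_nbrs \<alpha> \<omega> p. (h p - h q)\<^sup>2) =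
        (\<Sum>p\<in>W \<inter> G. \<Sum>q\<in>open_nbrs \<alpha> \<omega> p. (grad p q ?h \<eta>)\<^sup>2)"
      using G by (intro sum.cong refl) (auto simp: open_nbrs_def grad_def h_def)
    ultimately show ?thesis using uv by (simp add: grad_def h_def)
  qed
  have fm: "f \<in> borel_measurable ?nu"
    by (rule measurable_coord_algebra[OF f G])
  have meas: "(\<lambda>\<eta>. ennreal ((grad p q ?h \<eta>)\<^sup>2)) \<in> borel_measurable ?nu" if "p \<in> ?C" "q \<in> ?C" for p q
  proof -
    note [measurable] = measurable_compose[OF measurable_add_particle fm, OF that(1)]
      measurable_compose[OF measurable_add_particle fm, OF that(2)]
    show ?thesis unfolding grad_def by measurable
  qed
  have "J u v \<le> (\<integral>\<^sup>+\<eta>. ennreal ?c * (\<Sum>p\<in>W \<inter> G. \<Sum>q\<in>open_nbrs \<alpha> \<omega> p. ennreal ((grad p q ?h \<eta>)\<^sup>2)) \<partial>?nu)"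
    unfolding J_def
  proof (rule nn_integral_mono)
    fix \<eta> assume "\<eta> \<in> space ?nu"
    from ennreal_leI[OF pointwise[OF this]] m0
    show "ennreal ((grad u v ?h \<eta>)\<^sup>2) \<le>
        ennreal ?c * (\<Sum>p\<in>W \<inter> G. \<Sum>q\<in>open_nbrs \<alpha> \<omega> p. ennreal ((grad p q ?h \<eta>)\<^sup>2))"
      by (simp add: ennreal_mult' sum_nonneg)
  qed
  also have "\<dots> = ennreal ?c * (\<integral>\<^sup>+\<eta>. (\<Sum>p\<in>W \<inter> G. \<Sum>q\<in>open_nbrs \<alpha> \<omega> p. ennreal ((grad p q ?h \<eta>)\<^sup>2)) \<partial>?nu)"
    using G by (intro nn_integral_cmult borel_measurable_sum meas) (auto simp: open_nbrs_def)
  also have "(\<integral>\<^sup>+\<eta>. (\<Sum>p\<in>W \<inter> G. \<Sum>q\<in>open_nbrs \<alpha> \<omega> p. ennreal ((grad p q ?h \<eta>)\<^sup>2)) \<partial>?nu) =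
      (\<Sum>p\<in>W \<inter> G. \<integral>\<^sup>+\<eta>. (\<Sum>q\<in>open_nbrs \<alpha> \<omega> p. ennreal ((grad p q ?h \<eta>)\<^sup>2)) \<partial>?nu)"
    using G by (intro nn_integral_sum borel_measurable_sum meas) (auto simp: open_nbrs_def)
  also have "\<dots> = (\<Sum>p\<in>W \<inter> G. \<Sum>q\<in>open_nbrs \<alpha> \<omega> p. J p q)"
    unfolding J_def using G by (intro sum.cong refl nn_integral_sum meas) (auto simp: open_nbrs_def)
  finally show ?thesis .
qed

section \<open>Good points along a path and their multiplicities\<close>

text \<open>The point count of a box of radius 5K/4; it bounds both the points in a block and the
  blocks through a point.\<close>

definition block_bound :: "'d itself \<Rightarrow> nat \<Rightarrow> real" where
  "block_bound _ K = (5 * real K / 2 + 1) ^ CARD('d)"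

lemma block_bound_nonneg: "0 \<le> block_bound TYPE('d) K"
  by (simp add: block_bound_def)

lemma hull_bound_pos: "0 < L \<Longrightarrow> 0 < hull_bound TYPE('d::finite) L"
  by (auto simp: hull_bound_def intro!: add_pos_nonneg)

lemma card_mblock_le:
  fixes w :: "'d::finite site"
  shows "real (card (mblock K w (5 * real K / 4) \<inter> G)) \<le> block_bound TYPE('d) K"
    and "real (card {w :: 'd site. p \<in> mblock K w (5 * real K / 4)}) \<le> block_bound TYPE('d) K"
proof -
  have "real (card (mblock K w (5 * real K / 4) \<inter> G)) \<le> real (card (mblock K w (5 * real K / 4)))"
    by (intro of_nat_mono card_mono) auto
  then show "real (card (mblock K w (5 * real K / 4) \<inter> G)) \<le> block_bound TYPE('d) K"
    using card_mblock[of "5 * real K / 4" K w] by (simp add: block_bound_def)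
  show "real (card {w :: 'd site. p \<in> mblock K w (5 * real K / 4)}) \<le> block_bound TYPE('d) K"
    using card_mblock_centres(2)[of "5 * real K / 4" p K] by (simp add: block_bound_def)
qed

text \<open>A point in several blocks is counted once per block. This makes the energy additive over
  macroscopic sites; \<open>sum_local_energy\<close> bounds the overcount.\<close>

definition local_energy ::
  "nat \<Rightarrow> ('d::finite site \<Rightarrow> bool) \<Rightarrow> 'd site set \<Rightarrow> ('d site \<Rightarrow> ennreal) \<Rightarrow> 'd site \<Rightarrow> ennreal" where
  "local_energy K s G X a = (\<Sum>w\<in>black_hull s a. \<Sum>p\<in>mblock K w (5 * real K / 4) \<inter> G. X p)"

text \<open>Points are parametrised by triples (a, w, p): a site a of the path, w in its hull, p in
  the block of w. By \<open>good_point_macro\<close> only sites a that are not bad occur, so the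
  hulls are bounded; r \<ge> 1 turns 4r + 1 into 5r.\<close>

lemma W_region_good_points:
  fixes u v :: "'d::{finite,linorder} site"
  assumes K: "K > 0" and L: "L > 0" and r: "r \<ge> 1"
    and G: "G \<inter> bad_region K s L = {}"
    and uv: "\<And>i. real_of_int \<bar>u $ i - v $ i\<bar> \<le> 4 * r"
  defines "A \<equiv> macro_path K u v - bad_sites s L"
  shows "finite (W_region K s u v \<inter> G)"
    and "real (card (W_region K s u v \<inter> G)) \<le> 5 * real CARD('d) * r * (hull_bound TYPE('d) L * block_bound TYPE('d) K)"
    and "(\<Sum>p\<in>W_region K s u v \<inter> G. X p) \<le> (\<Sum>a\<in>A. local_energy K s G X a)"
proof -
  let ?S = "SIGMA a:A. SIGMA w:black_hull s a. mblock K w (5 * real K / 4) \<inter> G"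
  have cA: "real (card (macro_path K u v)) \<le> real CARD('d) * (4 * r + 1)"
    unfolding macro_path_def
  proof (rule card_coord_path(2))
    fix i
    show "real_of_int \<bar>macro_site K u $ i - macro_site K v $ i\<bar> \<le> 4 * r"
      using macro_site_lipschitz[of K u i v] uv[of i] by linarith
  qed
  have finM: "finite (macro_path K u v)" by (simp add: macro_path_def card_coord_path(1))
  have "card A \<le> card (macro_path K u v)" unfolding A_def by (intro card_mono finM) auto
  then have "real (card A) \<le> real CARD('d) * (4 * r + 1)" using cA by linarith
  also have "\<dots> \<le> real CARD('d) * (5 * r)" using r by (intro mult_left_mono) auto
  finally have cardA: "real (card A) \<le> 5 * real CARD('d) * r" by (simp add: mult_ac)
  have finA: "finite A" using finM by (simp add: A_def)
  have H: "finite (black_hull s a)" "real (card (black_hull s a)) \<le> hull_bound TYPE('d) L" if "a \<in> A" for a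
    using card_black_hull[OF L, of a s] that by (auto simp: A_def)
  have sub: "W_region K s u v \<inter> G \<subseteq> (\<lambda>t. snd (snd t)) ` ?S"
  proof
    fix p assume p: "p \<in> W_region K s u v \<inter> G"
    then obtain a w where aw: "a \<in> macro_path K u v" "w \<in> black_hull s a" "p \<in> mblock K w (5 * real K / 4)"
      by (auto simp: W_region_def)
    moreover have "a \<notin> bad_sites s L"
      using good_point_macro[OF K aw(3) _ aw(2)] p G by blast
    ultimately have "(a, w, p) \<in> ?S" using p by (auto simp: A_def)
    then show "p \<in> (\<lambda>t. snd (snd t)) ` ?S" by force
  qed
  have finS: "finite ?S" using finA H by (intro finite_SigmaI) auto
  show "finite (W_region K s u v \<inter> G)" using sub finS by (rule finite_subset[OF _ finite_imageI])
  have "card (W_region K s u v \<inter> G) \<le> card ?S"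
    by (rule surj_card_le[OF finS sub])
  also have "real (card ?S) \<le> 5 * real CARD('d) * r * (hull_bound TYPE('d) L * block_bound TYPE('d) K)"
    using finA H cardA L card_mblock_le(1) block_bound_nonneg[where 'd = 'd] hull_bound_pos[of L, where 'd = 'd]
    by (intro card_Sigma_le finite_SigmaI mult_nonneg_nonneg) (auto simp: less_imp_le)
  finally show "real (card (W_region K s u v \<inter> G)) \<le> 5 * real CARD('d) * r * (hull_bound TYPE('d) L * block_bound TYPE('d) K)"
    by simp
  have "(\<Sum>p\<in>W_region K s u v \<inter> G. X p) \<le> (\<Sum>p\<in>(\<lambda>t. snd (snd t)) ` ?S. X p)"
    using sub finS by (intro sum_mono2) auto
  also have "\<dots> \<le> (\<Sum>t\<in>?S. X (snd (snd t)))"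
    using sum_image_le[OF finS, of X "\<lambda>t. snd (snd t)"] by (simp add: comp_def)
  also have "\<dots> = (\<Sum>a\<in>A. \<Sum>q\<in>(SIGMA w:black_hull s a. mblock K w (5 * real K / 4) \<inter> G). X (snd q))"
    using finA H by (subst sum.Sigma) (auto simp: split_beta' intro!: finite_SigmaI)
  also have "\<dots> = (\<Sum>a\<in>A. local_energy K s G X a)"
    unfolding local_energy_def using H
    by (intro sum.cong refl, subst sum.Sigma) (auto simp: split_beta')
  finally show "(\<Sum>p\<in>W_region K s u v \<inter> G. X p) \<le> (\<Sum>a\<in>A. local_energy K s G X a)" .
qed

text \<open>The same triples read from p: few blocks contain p, and each of their centres lies in
  few hulls of sites that are not bad.\<close>

lemma sum_local_energy:
  fixes A :: "'d::finite site set"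
  assumes L: "L > 0" and A: "finite A" "A \<inter> bad_sites s L = {}"
  obtains S where "finite S" "S \<subseteq> G"
    "(\<Sum>a\<in>A. local_energy K s G X a) \<le> ennreal (block_bound TYPE('d) K * hull_bound TYPE('d) L) * (\<Sum>p\<in>S. X p)"
proof
  let ?S = "SIGMA a:A. SIGMA w:black_hull s a. mblock K w (5 * real K / 4) \<inter> G"
  let ?h = "\<lambda>t. snd (snd t)"
  have H: "finite (black_hull s a)" "a \<notin> bad_sites s L" if "a \<in> A" for a
    using card_black_hull(1)[OF L, of a s] that A by auto
  have finS: "finite ?S" using A H by (intro finite_SigmaI) auto
  show "finite (?h ` ?S)" "?h ` ?S \<subseteq> G" using finS by auto
  have "(\<Sum>a\<in>A. local_energy K s G X a) = (\<Sum>a\<in>A. \<Sum>q\<in>(SIGMA w:black_hull s a. mblock K w (5 * real K / 4) \<inter> G). X (snd q))"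
    unfolding local_energy_def using H
    by (intro sum.cong refl, subst sum.Sigma) (auto simp: split_beta')
  also have "\<dots> = (\<Sum>t\<in>?S. X (?h t))"
    using A H by (subst sum.Sigma) (auto simp: split_beta' intro!: finite_SigmaI)
  also have "\<dots> \<le> ennreal (block_bound TYPE('d) K * hull_bound TYPE('d) L) * (\<Sum>p\<in>?h ` ?S. X p)"
  proof (rule sum_fibre_bound[OF finS])
    fix p
    let ?B = "SIGMA w:{w. p \<in> mblock K w (5 * real K / 4)}. {a. a \<notin> bad_sites s L \<and> w \<in> black_hull s a}"
    have finB: "finite ?B"
      using card_mblock_centres(1)[of "5 * real K / 4" p K] card_hull_column(1)[OF L]
      by (intro finite_SigmaI) auto
    have "card {t \<in> ?S. ?h t = p} \<le> card ?B"
    proof (rule card_inj_on_le[OF _ _ finB])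
      show "inj_on (\<lambda>t. (fst (snd t), fst t)) {t \<in> ?S. ?h t = p}" by (auto simp: inj_on_def)
      show "(\<lambda>t. (fst (snd t), fst t)) ` {t \<in> ?S. ?h t = p} \<subseteq> ?B" using H by auto
    qed
    also have "real (card ?B) \<le> block_bound TYPE('d) K * hull_bound TYPE('d) L"
      using card_mblock_centres(1)[of "5 * real K / 4" p K] card_hull_column[OF L] card_mblock_le(2)
        hull_bound_pos[OF L, where 'd = 'd]
      by (intro card_Sigma_le) (auto simp: less_imp_le)
    finally show "real (card {t \<in> ?S. ?h t = p}) \<le> block_bound TYPE('d) K * hull_bound TYPE('d) L"
      by simp
  qed (use finS in auto)
  finally show "(\<Sum>a\<in>A. local_energy K s G X a) \<le>
    ennreal (block_bound TYPE('d) K * hull_bound TYPE('d) L) * (\<Sum>p\<in>?h ` ?S. X p)" .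
qed


section \<open>Summation over boxes\<close>

lemma card_box_configurations:
  fixes u v :: "'d::finite site"
  assumes "0 \<le> r" "T \<subseteq> {(x, y, z, u', v'). u' = u \<and> v' = v \<and> y \<in> lbox u l \<and> z \<in> lbox v l \<and> x \<in> lbox y r}"
    "0 \<le> l"
  shows "real (card T) \<le> (2 * l + 1) ^ (2 * CARD('d)) * (2 * r + 1) ^ CARD('d)"
proof -
  let ?B = "SIGMA y:lbox u l. SIGMA z:lbox v l. lbox y r"
  have finB: "finite ?B" by simp
  have "T \<subseteq> (\<lambda>(y, z, x). (x, y, z, u, v)) ` ?B"
  proof
    fix t assume "t \<in> T"
    then obtain x y z where "t = (x, y, z, u, v)" "y \<in> lbox u l" "z \<in> lbox v l" "x \<in> lbox y r"
      using assms(2) by blast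
    then show "t \<in> (\<lambda>(y, z, x). (x, y, z, u, v)) ` ?B"
      by (intro image_eqI[of _ _ "(y, z, x)"]) simp_all
  qed
  then have "card T \<le> card ?B" by (rule surj_card_le[OF finB])
  also have "real (card ?B) \<le> (2 * l + 1) ^ CARD('d) * ((2 * l + 1) ^ CARD('d) * (2 * r + 1) ^ CARD('d))"
  proof (rule card_Sigma_le)
    show "real (card (SIGMA z:lbox v l. lbox y r)) \<le> (2 * l + 1) ^ CARD('d) * (2 * r + 1) ^ CARD('d)" for y :: "'d site"
      by (rule card_Sigma_le) (simp_all add: card_lbox assms)
  qed (simp_all add: card_lbox assms)
  finally show ?thesis by (simp only: power_even_eq power2_eq_square mult.assoc of_nat_le_iff)
qed

lemma sum_Sigma_snd:
  assumes "finite A" "\<And>x. x \<in> A \<Longrightarrow> finite (B x)"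
  shows "(\<Sum>x\<in>A. \<Sum>t\<in>B x. F t) = (\<Sum>t\<in>Sigma A B. F (snd t))"
  using assms by (simp add: sum.Sigma split_beta')

text \<open>Pure counting: the path estimate enters as the assumption on \<open>J\<close>, free of
  integrals. The constant is a product of four factors: box configurations per pair (u, v), the
  Cauchy-Schwarz factor, pairs per macroscopic site, and blocks and hulls per point.\<close>

lemma sum_box_configurations:
  fixes J :: "'d::{finite,linorder} site \<Rightarrow> 'd site \<Rightarrow> ennreal" and K l :: nat
  assumes K: "K > 0" and L: "L > 0" and r: "r \<ge> 1"
    and G: "G \<inter> bad_region K s L = {}"
    and J: "\<And>u v m. u \<in> C \<Longrightarrow> v \<in> C \<Longrightarrow> finite (W_region K s u v \<inter> G) \<Longrightarrow>
      real (card (W_region K s u v \<inter> G)) \<le> m \<Longrightarrow>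
      J u v \<le> ennreal (8 * real CARD('d) * m) * (\<Sum>p\<in>W_region K s u v \<inter> G. X p)"
  defines "hb \<equiv> hull_bound TYPE('d) L * block_bound TYPE('d) K"
  obtains S where "finite S" "S \<subseteq> G"
    "(\<Sum>x\<in>lbox 0 R. \<Sum>y\<in>lbox x r. \<Sum>z\<in>{z \<in> lbox x r. sup_norm (z - y) \<ge> 2 * int l}.
        \<Sum>u\<in>good_points K s L C y (real l). \<Sum>v\<in>good_points K s L C z (real l). J u v)
      \<le> ennreal ((2 * real l + 1) ^ (2 * CARD('d)) * (2 * r + 1) ^ CARD('d) *
          (8 * real CARD('d) * (5 * real CARD('d) * r * hb)) *
          (real CARD('d) * (9 * (2 * real K + 9)) ^ CARD('d) * r ^ (CARD('d) + 1)) * hb) * (\<Sum>p\<in>S. X p)"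
proof -
  let ?gp = "\<lambda>y. good_points K s L C y (real l)"
  let ?Z = "\<lambda>x y. {z \<in> lbox x r. sup_norm (z - y) \<ge> 2 * int l}"
  let ?T = "SIGMA x:lbox 0 R. SIGMA y:lbox x r. SIGMA z:?Z x y. ?gp y \<times> ?gp z"
  let ?h = "\<lambda>t. snd (snd (snd t))"
  \<comment> \<open>As a set, \<open>P\<close> forgets x, y and z; the multiplicity of each pair is
    bounded by \<open>c1\<close>.\<close>
  define P where "P = ?h ` ?T"
  define c1 where "c1 = (2 * real l + 1) ^ (2 * CARD('d)) * (2 * r + 1) ^ CARD('d)"
  define c2 where "c2 = 8 * real CARD('d) * (5 * real CARD('d) * r * hb)"
  define c3 where "c3 = real CARD('d) * (9 * (2 * real K + 9)) ^ CARD('d) * r ^ (CARD('d) + 1)"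
  have hb: "0 \<le> hb" unfolding hb_def
    using block_bound_nonneg[where 'd = 'd] hull_bound_pos[OF L, where 'd = 'd]
    by (intro mult_nonneg_nonneg) (auto simp: less_imp_le)
  have c: "0 \<le> c1" "0 \<le> c2" "0 \<le> c3"
    using r hb by (auto simp: c1_def c2_def c3_def)
  have fingp: "finite (?gp y)" for y by (simp add: good_points_def)
  have finZ: "finite (?Z x y)" for x y by (rule finite_subset[OF _ finite_lbox]) blast
  have fin1: "finite (?gp y \<times> ?gp z)" for y z by (intro finite_cartesian_product fingp)
  have fin2: "finite (SIGMA z:?Z x y. ?gp y \<times> ?gp z)" for x y by (intro finite_SigmaI finZ fin1)
  have fin3: "finite (SIGMA y:lbox x r. SIGMA z:?Z x y. ?gp y \<times> ?gp z)" for x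
    by (intro finite_SigmaI finite_lbox fin2)
  have finT: "finite ?T" by (intro finite_SigmaI finite_lbox fin3)
  have finP: "finite P" unfolding P_def by (intro finite_imageI finT)
  have fin4: "finite (macro_path K u v - bad_sites s L)" for u v
    by (intro finite_Diff) (simp add: macro_path_def card_coord_path(1))
  have PD: "u \<in> C \<and> v \<in> C \<and> (\<forall>i. real_of_int \<bar>u $ i - v $ i\<bar> \<le> 4 * r)" if "(u, v) \<in> P" for u v
  proof -
    have gp: "p \<in> lbox q l \<and> p \<in> C" if "p \<in> ?gp q" for p q
      using that by (simp add: good_points_def)
    obtain t where t: "t \<in> ?T" "(u, v) = ?h t"
      using \<open>(u, v) \<in> P\<close> unfolding P_def by (rule imageE)
    obtain x y z u' v' where "t = (x, y, z, u', v')" by (cases t rule: prod_cases5)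
    then have "y \<in> lbox x r" "z \<in> lbox x r" "sup_norm (z - y) \<ge> 2 * int l" "u \<in> ?gp y" "v \<in> ?gp z"
      using t by simp_all
    then have t: "y \<in> lbox x r" "z \<in> lbox x r" "sup_norm (z - y) \<ge> 2 * int l"
      "u \<in> lbox y l" "v \<in> lbox z l" "u \<in> C" "v \<in> C"
      using gp by blast+
    have yz: "real_of_int \<bar>z $ i - y $ i\<bar> \<le> 2 * r" for i
      using t(1,2)[unfolded lbox_def mem_Collect_eq, THEN spec, of i] by simp
    have "sup_norm (z - y) \<in> range (\<lambda>i. \<bar>(z - y) $ i\<bar>)"
      unfolding sup_norm_def by (intro Max_in) auto
    then obtain i where "sup_norm (z - y) = \<bar>z $ i - y $ i\<bar>" by auto
    \<comment> \<open>From 2l \<le> |z - y| \<le> 2r one gets l \<le> r, hence |u - v| \<le> 2l + 2r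
      \<le> 4r, a bound free of l.\<close>
    then have "real l \<le> r" using t(3) yz[of i] by simp
    then have "real_of_int \<bar>u $ i - v $ i\<bar> \<le> 4 * r" for i
      using t(4,5)[unfolded lbox_def mem_Collect_eq, THEN spec, of i] yz[of i] by simp
    then show ?thesis using t by blast
  qed
  have "(\<Sum>x\<in>lbox 0 R. \<Sum>y\<in>lbox x r. \<Sum>z\<in>?Z x y. \<Sum>u\<in>?gp y. \<Sum>v\<in>?gp z. J u v) =
      (\<Sum>x\<in>lbox 0 R. \<Sum>y\<in>lbox x r. \<Sum>z\<in>?Z x y. \<Sum>t\<in>?gp y \<times> ?gp z. case_prod J t)"
    by (simp only: sum.cartesian_product split_beta')
  also have "\<dots> = (\<Sum>t\<in>?T. case_prod J (?h t))"
    by (simp only: sum_Sigma_snd finite_lbox finZ fin1 fin2 fin3)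
  also have "\<dots> \<le> ennreal c1 * (\<Sum>uv\<in>P. case_prod J uv)"
  proof (rule sum_fibre_bound[OF finT])
    show "?h ` ?T \<subseteq> P" "finite P" by (simp_all add: P_def finT)
    fix uv :: "'d site \<times> 'd site"
    obtain u v where uv: "uv = (u, v)" by force
    show "real (card {t \<in> ?T. ?h t = uv}) \<le> c1"
      unfolding c1_def
    proof (rule card_box_configurations)
      show "{t \<in> ?T. ?h t = uv} \<subseteq> {(x, y, z, u', v'). u' = u \<and> v' = v \<and> y \<in> lbox u l \<and> z \<in> lbox v l \<and> x \<in> lbox y r}"
      proof
        fix t assume "t \<in> {t \<in> ?T. ?h t = uv}"
        then have t: "t \<in> ?T" "?h t = (u, v)" using uv by simp_all
        obtain x y z u' v' where t': "t = (x, y, z, u', v')" by (cases t rule: prod_cases5)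
        have "y \<in> lbox x r" "u \<in> lbox y l" "v \<in> lbox z l" "u' = u" "v' = v"
          using t unfolding t' good_points_def by simp_all
        then have "y \<in> lbox u l \<and> z \<in> lbox v l \<and> x \<in> lbox y r \<and> u' = u \<and> v' = v"
          using lbox_sym[of y u l] lbox_sym[of z v l] lbox_sym[of x y r] by blast
        then show "t \<in> {(x, y, z, u', v'). u' = u \<and> v' = v \<and> y \<in> lbox u l \<and> z \<in> lbox v l \<and> x \<in> lbox y r}"
          unfolding t' by simp
      qed
    qed (use r in auto)
  qed
  finally have S1: "(\<Sum>x\<in>lbox 0 R. \<Sum>y\<in>lbox x r. \<Sum>z\<in>?Z x y. \<Sum>u\<in>?gp y. \<Sum>v\<in>?gp z. J u v) \<le>
      ennreal c1 * (\<Sum>uv\<in>P. case_prod J uv)" .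
  have "(\<Sum>uv\<in>P. case_prod J uv) \<le>
      (\<Sum>uv\<in>P. ennreal c2 * (\<Sum>a\<in>macro_path K (fst uv) (snd uv) - bad_sites s L. local_energy K s G X a))"
  proof (rule sum_mono)
    fix uv assume uv: "uv \<in> P"
    obtain u v where uv': "uv = (u, v)" by force
    note Puv = PD[OF uv[unfolded uv']]
    have "real_of_int \<bar>u $ i - v $ i\<bar> \<le> 4 * r" for i using Puv by blast
    note W = W_region_good_points[OF K L r G this]
    have "J u v \<le> ennreal c2 * (\<Sum>p\<in>W_region K s u v \<inter> G. X p)"
      unfolding c2_def hb_def
      by (rule J[OF conjunct1[OF Puv] conjunct1[OF conjunct2[OF Puv]] W(1,2)])
    also have "\<dots> \<le> ennreal c2 * (\<Sum>a\<in>macro_path K u v - bad_sites s L. local_energy K s G X a)"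
      by (rule mult_left_mono[OF W(3)]) simp
    finally show "case_prod J uv \<le> ennreal c2 *
        (\<Sum>a\<in>macro_path K (fst uv) (snd uv) - bad_sites s L. local_energy K s G X a)"
      by (simp add: uv')
  qed
  also have "\<dots> = ennreal c2 * (\<Sum>uv\<in>P. \<Sum>a\<in>macro_path K (fst uv) (snd uv) - bad_sites s L. local_energy K s G X a)"
    by (simp only: sum_distrib_left)
  finally have S2: "(\<Sum>uv\<in>P. case_prod J uv) \<le>
      ennreal c2 * (\<Sum>uv\<in>P. \<Sum>a\<in>macro_path K (fst uv) (snd uv) - bad_sites s L. local_energy K s G X a)" .
  have "(\<Sum>uv\<in>P. \<Sum>a\<in>macro_path K (fst uv) (snd uv) - bad_sites s L. local_energy K s G X a) =
      (\<Sum>t\<in>(SIGMA uv:P. macro_path K (fst uv) (snd uv) - bad_sites s L). local_energy K s G X (snd t))"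
    by (intro sum_Sigma_snd finP fin4)
  also have "\<dots> \<le> ennreal c3 * (\<Sum>a\<in>snd ` (SIGMA uv:P. macro_path K (fst uv) (snd uv) - bad_sites s L). local_energy K s G X a)"
    (is "_ \<le> _ * (\<Sum>a\<in>?A. _)")
  proof (rule sum_fibre_bound[OF _ order_refl])
    let ?Q = "SIGMA uv:P. macro_path K (fst uv) (snd uv) - bad_sites s L"
    show finQ: "finite ?Q"
      by (intro finite_SigmaI finP fin4)
    then show "finite ?A" by simp
    fix a :: "'d site"
    let ?V = "{(u, v). (\<forall>j. real_of_int \<bar>u $ j - v $ j\<bar> \<le> 4 * r) \<and> a \<in> macro_path K u v}"
    have "card {t \<in> ?Q. snd t = a} \<le> card ?V"
    proof (rule card_inj_on_le[OF _ _ card_pairs_through(1)[OF r]])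
      show "inj_on fst {t \<in> ?Q. snd t = a}" by (auto simp: inj_on_def)
      show "fst ` {t \<in> ?Q. snd t = a} \<subseteq> ?V"
      proof
        fix uv assume "uv \<in> fst ` {t \<in> ?Q. snd t = a}"
        then have "uv \<in> P" "a \<in> macro_path K (fst uv) (snd uv)" by auto
        then show "uv \<in> ?V" using PD[of "fst uv" "snd uv"] by (auto simp: split_beta')
      qed
    qed
    also have "real (card ?V) \<le> c3" unfolding c3_def by (rule card_pairs_through(2)[OF r])
    finally show "real (card {t \<in> ?Q. snd t = a}) \<le> c3" by simp
  qed
  finally have S3: "(\<Sum>uv\<in>P. \<Sum>a\<in>macro_path K (fst uv) (snd uv) - bad_sites s L. local_energy K s G X a) \<le>
      ennreal c3 * (\<Sum>a\<in>?A. local_energy K s G X a)" .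
  have "finite ?A" "?A \<inter> bad_sites s L = {}"
    by (intro finite_imageI finite_SigmaI finP fin4) auto
  from sum_local_energy[OF L this] obtain S where S: "finite S" "S \<subseteq> G"
    "(\<Sum>a\<in>?A. local_energy K s G X a) \<le> ennreal (block_bound TYPE('d) K * hull_bound TYPE('d) L) * (\<Sum>p\<in>S. X p)" .
  have "(\<Sum>a\<in>?A. local_energy K s G X a) \<le> ennreal hb * (\<Sum>p\<in>S. X p)"
    using S(3) unfolding hb_def mult.commute[of "hull_bound _ _"] .
  from order_trans[OF S1 mult_left_mono[OF order_trans[OF S2 mult_left_mono[OF order_trans[OF S3 mult_left_mono[OF this]]]]]]
  have "(\<Sum>x\<in>lbox 0 R. \<Sum>y\<in>lbox x r. \<Sum>z\<in>?Z x y. \<Sum>u\<in>?gp y. \<Sum>v\<in>?gp z. J u v) \<le>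
      ennreal c1 * (ennreal c2 * (ennreal c3 * (ennreal hb * (\<Sum>p\<in>S. X p))))"
    by simp
  also have "\<dots> = ennreal (c1 * c2 * c3 * hb) * (\<Sum>p\<in>S. X p)"
    using c hb by (simp add: ennreal_mult' mult.assoc)
  finally show ?thesis
    unfolding c1_def c2_def c3_def by (rule that[OF S(1,2)])
qed

section \<open>The constant, the scaling and the conclusion\<close>

lemma lbox_less_one: "r < 1 \<Longrightarrow> y \<in> lbox x r \<Longrightarrow> y = x"
proof -
  assume r: "r < 1" and y: "y \<in> lbox x r"
  have "y $ i = x $ i" for i
  proof -
    have "real_of_int \<bar>y $ i - x $ i\<bar> \<le> r" using y unfolding lbox_def by blast
    then have "real_of_int \<bar>y $ i - x $ i\<bar> < 1" using r by (rule le_less_trans)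
    then show ?thesis by linarith
  qed
  then show "y = x" by (simp add: vec_eq_iff)
qed

text \<open>The reciprocal of \<kappa>. Here 3^d stems from 2r + 1 \<le> 3r, 8d times 5d from the
  path estimate, the next factor from the pairs through a macroscopic site, and 2/\<alpha> from the
  Dirichlet form. Hull and block bounds are squared: once for the good points per path, once for the
  multiplicity of a point.\<close>

definition moving_particle_const :: "'d itself \<Rightarrow> nat \<Rightarrow> real \<Rightarrow> real \<Rightarrow> real" where
  "moving_particle_const _ K \<alpha> L = 3 ^ CARD('d) * (8 * real CARD('d) * (5 * real CARD('d))) *
     (real CARD('d) * (9 * (2 * real K + 9)) ^ CARD('d)) *
     (hull_bound TYPE('d) L * block_bound TYPE('d) K)\<^sup>2 * (2 / \<alpha>)"

lemma moving_particle_const_pos: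
  assumes "L > 0" "\<alpha> > 0"
  shows "moving_particle_const TYPE('d::finite) K \<alpha> L > 0"
proof -
  define hb where "hb = hull_bound TYPE('d) L * block_bound TYPE('d) K"
  have "0 < hb"
    unfolding hb_def block_bound_def using hull_bound_pos[OF assms(1)]
    by (intro mult_pos_pos zero_less_power add_nonneg_pos) auto
  then show ?thesis
    unfolding moving_particle_const_def hb_def[symmetric] using assms by simp
qed

text \<open>Powers of r: d from the position of x, 1 from the number of good points, d + 1 from the
  pairs. After division by r^(2d) there remains r^2 = \<epsilon>^2 n^2, which cancels
  \<epsilon>^(-2) and leaves n^(2-d); the powers of t cancel.\<close>

lemma moving_particle_scaling:
  fixes n \<epsilon> r q hb t :: real
  assumes n: "n \<ge> 1" and \<epsilon>: "\<epsilon> > 0" and r: "r = \<epsilon> * n" "r \<ge> 1" and t: "t \<ge> 1"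
    and nn: "q \<ge> 0" "hb \<ge> 0" "\<alpha> > 0"
  shows "\<epsilon> powi (-2) / (n ^ d * r ^ (2 * d) * t ^ (2 * d)) *
      (t ^ (2 * d) * (2 * r + 1) ^ d * (8 * real d * (5 * real d * r * hb)) *
        (real d * q * r ^ (d + 1)) * hb * (2 / \<alpha>)) \<le>
    n powi (2 - int d) * (3 ^ d * (8 * real d * (5 * real d)) * (real d * q) * hb\<^sup>2 * (2 / \<alpha>))"
    (is "?c * ?B \<le> _ * ?\<Theta>")
proof -
  have pos: "r > 0" "n > 0" "t > 0" using n r t by auto
  have "(2 * r + 1) ^ d \<le> (3 * r) ^ d" using r by (intro power_mono) auto
  then have "?B \<le> t ^ (2 * d) * (3 * r) ^ d * (8 * real d * (5 * real d * r * hb)) *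
        (real d * q * r ^ (d + 1)) * hb * (2 / \<alpha>)"
    using pos nn by (intro mult_right_mono mult_left_mono) auto
  also have "\<dots> = t ^ (2 * d) * r ^ (2 * d) * r\<^sup>2 * ?\<Theta>"
    by (simp add: power_mult_distrib power_mult power2_eq_square mult_ac)
  finally have "?c * ?B \<le> ?c * (t ^ (2 * d) * r ^ (2 * d) * r\<^sup>2 * ?\<Theta>)"
    using pos \<epsilon> by (intro mult_left_mono) auto
  also have "\<dots> = \<epsilon> powi (-2) * r\<^sup>2 / n ^ d * ?\<Theta>"
    using pos by (simp add: field_simps)
  also have "\<epsilon> powi (-2) * r\<^sup>2 = n\<^sup>2"
    using \<epsilon> by (simp add: r(1) power_int_minus power_mult_distrib)
  also have "n\<^sup>2 / n ^ d = n powi (2 - int d)"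
    using pos by (simp add: power_int_diff)
  finally show ?thesis .
qed

theorem lemma5p2:
  fixes \<mu> :: "real measure" and c0 \<alpha>0 \<alpha> \<rho> :: real
    and g :: "nat \<Rightarrow> real" and pbar :: "nat \<Rightarrow> real" and K :: nat
    and \<sigma> :: "('d::{finite,linorder} bond \<Rightarrow> bool) \<Rightarrow> 'd site \<Rightarrow> bool"
  assumes dim: "CARD('d) \<ge> 2"
    and law: "prob_space \<mu>" "sets \<mu> = sets borel" "c0 > 0" "AE t in \<mu>. 0 \<le> t \<and> t \<le> c0"
    and supercritical: "pc_bond TYPE('d) < measure \<mu> {t. t > 0}"
    and alpha0: "\<alpha>0 > 0" "\<And>\<beta>. 0 < \<beta> \<Longrightarrow> \<beta> \<le> \<alpha>0 \<Longrightarrow> pc_bond TYPE('d) < measure \<mu> {t. t > \<beta>}"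
    and rate: "zero_range_rate g"
    and rho: "\<rho> > 0"
    and alpha: "0 < \<alpha>" "\<alpha> \<le> \<alpha>0"
    and K: "K > 0"
    and field: "renormalized_field \<mu> \<alpha> pbar K \<sigma>"
  shows "\<exists>\<kappa> :: real \<Rightarrow> real. (\<forall>L>0. \<kappa> L > 0) \<and>
    (AE \<omega> in env_law \<mu>. \<forall>L>0. \<forall>N\<ge>1. \<forall>l :: nat. \<forall>\<epsilon>>0. \<forall>C0>0.
       \<forall>f \<in> Upsilon_sharp g \<rho> K \<sigma> \<alpha> L \<omega> C0 N.
         ennreal (\<epsilon> powi (-2) * phi_of g \<rho> /
             (real N ^ CARD('d) * (\<epsilon> * real N) ^ (2 * CARD('d)) * (2 * real l + 1) ^ (2 * CARD('d)))) *
           (\<Sum>x\<in>lbox 0 (real N). \<Sum>y\<in>lbox x (\<epsilon> * real N).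
              \<Sum>z\<in>{z \<in> lbox x (\<epsilon> * real N). sup_norm (z - y) \<ge> 2 * int l}.
                \<Sum>u\<in>good_points K (\<sigma> (hat \<alpha> \<omega>)) L (clus \<alpha> \<omega>) y (real l).
                  \<Sum>v\<in>good_points K (\<sigma> (hat \<alpha> \<omega>)) L (clus \<alpha> \<omega>) z (real l).
                    \<integral>\<^sup>+\<eta>. ennreal ((grad u v (\<lambda>\<xi>. sqrt (f \<xi>)) \<eta>)\<^sup>2) \<partial>nu g \<rho> (clus 0 \<omega>))
         \<le> ennreal (real N powi (2 - int CARD('d))) * dirichlet g \<rho> \<omega> f / ennreal (\<kappa> L)
       \<and> ennreal (real N powi (2 - int CARD('d))) * dirichlet g \<rho> \<omega> f / ennreal (\<kappa> L)
         \<le> ennreal (C0 / \<kappa> L))"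
proof (intro exI conjI allI impI)
  let ?\<Theta> = "moving_particle_const TYPE('d) K \<alpha>"
  let ?\<kappa> = "\<lambda>L. 1 / ?\<Theta> L"
  show "?\<kappa> L > 0" if "L > 0" for L using moving_particle_const_pos[OF that alpha(1), where 'd = 'd] by simp
  have "AE \<omega> in env_law \<mu>. \<forall>x\<in>clus \<alpha> \<omega>. \<forall>y\<in>clus \<alpha> \<omega>.
      joined_within (hat \<alpha> \<omega>) (clus \<alpha> \<omega> \<inter> W_region K (\<sigma> (hat \<alpha> \<omega>)) x y) x y"
    using field unfolding renormalized_field_def by blast
  then show "AE \<omega> in env_law \<mu>. \<forall>L>0. \<forall>N\<ge>1. \<forall>l :: nat. \<forall>\<epsilon>>0. \<forall>C0>0.
       \<forall>f \<in> Upsilon_sharp g \<rho> K \<sigma> \<alpha> L \<omega> C0 N.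
         ennreal (\<epsilon> powi (-2) * phi_of g \<rho> /
             (real N ^ CARD('d) * (\<epsilon> * real N) ^ (2 * CARD('d)) * (2 * real l + 1) ^ (2 * CARD('d)))) *
           (\<Sum>x\<in>lbox 0 (real N). \<Sum>y\<in>lbox x (\<epsilon> * real N).
              \<Sum>z\<in>{z \<in> lbox x (\<epsilon> * real N). sup_norm (z - y) \<ge> 2 * int l}.
                \<Sum>u\<in>good_points K (\<sigma> (hat \<alpha> \<omega>)) L (clus \<alpha> \<omega>) y (real l).
                  \<Sum>v\<in>good_points K (\<sigma> (hat \<alpha> \<omega>)) L (clus \<alpha> \<omega>) z (real l).
                    \<integral>\<^sup>+\<eta>. ennreal ((grad u v (\<lambda>\<xi>. sqrt (f \<xi>)) \<eta>)\<^sup>2) \<partial>nu g \<rho> (clus 0 \<omega>))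
         \<le> ennreal (real N powi (2 - int CARD('d))) * dirichlet g \<rho> \<omega> f / ennreal (?\<kappa> L)
       \<and> ennreal (real N powi (2 - int CARD('d))) * dirichlet g \<rho> \<omega> f / ennreal (?\<kappa> L)
         \<le> ennreal (C0 / ?\<kappa> L)"
  \<comment> \<open>A single null set serves all L, N, l, \<epsilon>, C0 and f: off it the argument
    is deterministic.\<close>
  proof (rule AE_mp, intro AE_I2 impI allI ballI)
    fix \<omega> :: "'d bond \<Rightarrow> real" and L :: real and N l :: nat and \<epsilon> C0 :: real and f
    assume joined: "\<forall>x\<in>clus \<alpha> \<omega>. \<forall>y\<in>clus \<alpha> \<omega>.
        joined_within (hat \<alpha> \<omega>) (clus \<alpha> \<omega> \<inter> W_region K (\<sigma> (hat \<alpha> \<omega>)) x y) x y"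
      and L: "0 < L" and N: "1 \<le> N" and \<epsilon>: "0 < \<epsilon>" and C0: "0 < C0"
      and f: "f \<in> Upsilon_sharp g \<rho> K \<sigma> \<alpha> L \<omega> C0 N"
    let ?s = "\<sigma> (hat \<alpha> \<omega>)" and ?C = "clus 0 \<omega>" and ?d = "CARD('d)"
    define J where "J p q = (\<integral>\<^sup>+\<eta>. ennreal ((grad p q (\<lambda>\<xi>. sqrt (f \<xi>)) \<eta>)\<^sup>2) \<partial>nu g \<rho> ?C)" for p q
    define r where "r = \<epsilon> * real N"
    define D where "D = dirichlet g \<rho> \<omega> f"
    define G where "G = good_points K ?s L (clus \<alpha> \<omega>) 0 (real N + 1)"
    let ?sum = "\<Sum>x\<in>lbox 0 (real N). \<Sum>y\<in>lbox x r. \<Sum>z\<in>{z \<in> lbox x r. sup_norm (z - y) \<ge> 2 * int l}.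
      \<Sum>u\<in>good_points K ?s L (clus \<alpha> \<omega>) y (real l). \<Sum>v\<in>good_points K ?s L (clus \<alpha> \<omega>) z (real l). J u v"
    define c where "c = \<epsilon> powi (-2) / (real N ^ ?d * r ^ (2 * ?d) * (2 * real l + 1) ^ (2 * ?d))"
    have \<Theta>: "?\<Theta> L > 0" using moving_particle_const_pos[OF L alpha(1)] .
    have fG: "f \<in> borel_measurable (coord_algebra ?C G)"
      and D: "D \<le> ennreal (C0 * real N ^ (?d - 2))"
      using f by (auto simp: Upsilon_sharp_def G_def D_def)
    have GC: "G \<subseteq> ?C"
      using clus_antimono[of 0 \<alpha> \<omega>] alpha by (auto simp: G_def good_points_def)
    have Gbad: "G \<inter> bad_region K ?s L = {}" by (auto simp: G_def good_points_def)
    have \<phi>: "0 \<le> phi_of g \<rho>" by (rule phi_of_bounds[OF rate rho])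
    have div: "X / ennreal (?\<kappa> L) = X * ennreal (?\<Theta> L)" for X
      using \<Theta> by (simp add: divide_ennreal_def inverse_ennreal)
    have main: "ennreal (c * phi_of g \<rho>) * ?sum \<le> ennreal (real N powi (2 - int ?d)) * D * ennreal (?\<Theta> L)"
    \<comment> \<open>For r < 1 the boxes reduce to x, so y = z = x; the separation forces l = 0,
      then u = v and every gradient vanishes.\<close>
    proof (cases "r < 1")
      case True
      have "J u v = 0" if "y \<in> lbox x r" "z \<in> {z \<in> lbox x r. sup_norm (z - y) \<ge> 2 * int l}"
        "u \<in> good_points K ?s L (clus \<alpha> \<omega>) y (real l)" "v \<in> good_points K ?s L (clus \<alpha> \<omega>) z (real l)" for x y z u v
      proof -
        have "y = x" "z = x" using that True lbox_less_one by blast+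
        then have "l = 0" using that(2) by (simp add: sup_norm_def)
        then have "u = x" "v = x"
          using that(3,4) lbox_less_one[of 0] \<open>y = x\<close> \<open>z = x\<close> by (auto simp: good_points_def)
        then show ?thesis by (simp add: J_def grad_def)
      qed
      then have "?sum = 0" by (intro sum.neutral ballI)
      then show ?thesis by simp
    next
      case False
      let ?X = "\<lambda>p. \<Sum>q\<in>open_nbrs \<alpha> \<omega> p. J p q"
      define hb where "hb = hull_bound TYPE('d) L * block_bound TYPE('d) K"
      define B where "B = (2 * real l + 1) ^ (2 * ?d) * (2 * r + 1) ^ ?d * (8 * real ?d * (5 * real ?d * r * hb)) *
          (real ?d * (9 * (2 * real K + 9)) ^ ?d * r ^ (?d + 1)) * hb"
      have r: "1 \<le> r" using False by simp
      have hb: "0 \<le> hb"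
        unfolding hb_def using hull_bound_pos[OF L, where 'd = 'd] block_bound_nonneg[where 'd = 'd] by (simp add: less_imp_le)
      have path: "J u v \<le> ennreal (8 * real ?d * m) * (\<Sum>p\<in>W_region K ?s u v \<inter> G. ?X p)"
        if "u \<in> clus \<alpha> \<omega>" "v \<in> clus \<alpha> \<omega>" "finite (W_region K ?s u v \<inter> G)"
          "real (card (W_region K ?s u v \<inter> G)) \<le> m" for u v m
        unfolding J_def using joined that by (intro nn_integral_grad_path[OF alpha(1) fG GC]) auto
      obtain S where S: "finite S" "S \<subseteq> G" "?sum \<le> ennreal B * (\<Sum>p\<in>S. ?X p)"
        unfolding B_def hb_def by (rule sum_box_configurations[OF K L r Gbad path])
      have "ennreal (phi_of g \<rho>) * (\<Sum>p\<in>S. ?X p) \<le> ennreal (2 / \<alpha>) * D"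
        unfolding J_def D_def
        using S(1,2) GC by (intro dirichlet_lower_bound[OF rate rho alpha(1)] measurable_coord_algebra[OF fG GC]) auto
      \<comment> \<open>The fugacity is grouped with the energy sum, because the comparison with the
        Dirichlet form bounds exactly this product.\<close>
      then have 2: "ennreal c * ennreal B * (ennreal (phi_of g \<rho>) * (\<Sum>p\<in>S. ?X p)) \<le>
          ennreal c * ennreal B * (ennreal (2 / \<alpha>) * D)"
        by (rule mult_left_mono) simp
      have "ennreal (c * phi_of g \<rho>) * ?sum \<le> ennreal (c * phi_of g \<rho>) * (ennreal B * (\<Sum>p\<in>S. ?X p))"
        by (rule mult_left_mono[OF S(3)]) simp
      also have "\<dots> = ennreal c * ennreal B * (ennreal (phi_of g \<rho>) * (\<Sum>p\<in>S. ?X p))"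
        using ennreal_mult''[OF \<phi>, of c] by (simp add: mult_ac)
      also note 2
      also have "ennreal c * ennreal B * (ennreal (2 / \<alpha>) * D) = ennreal (c * (B * (2 / \<alpha>))) * D"
      proof -
        have B: "0 \<le> B * (2 / \<alpha>)" unfolding B_def using r hb alpha(1) by (intro mult_nonneg_nonneg) auto
        have "ennreal (c * (B * (2 / \<alpha>))) = ennreal c * ennreal (B * (2 / \<alpha>))"
          by (rule ennreal_mult''[OF B])
        also have "ennreal (B * (2 / \<alpha>)) = ennreal B * ennreal (2 / \<alpha>)"
          using alpha(1) by (intro ennreal_mult'') simp
        finally show ?thesis by (simp only: mult.assoc)
      qed
      also have "\<dots> \<le> ennreal (real N powi (2 - int ?d) * ?\<Theta> L) * D"
      proof (intro mult_right_mono ennreal_leI)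
        show "c * (B * (2 / \<alpha>)) \<le> real N powi (2 - int ?d) * ?\<Theta> L"
          unfolding moving_particle_const_def c_def B_def hb_def[symmetric] using N \<epsilon> r hb alpha(1)
          by (intro moving_particle_scaling) (auto simp: r_def)
      qed simp
      also have "\<dots> = ennreal (real N powi (2 - int ?d)) * D * ennreal (?\<Theta> L)"
        using \<Theta> by (simp add: ennreal_mult'' mult_ac)
      finally show ?thesis .
    qed
    have "ennreal (real N powi (2 - int ?d)) * D * ennreal (?\<Theta> L) \<le>
        ennreal (real N powi (2 - int ?d)) * ennreal (C0 * real N ^ (?d - 2)) * ennreal (?\<Theta> L)"
      by (intro mult_right_mono[OF mult_left_mono[OF D]]) simp_all
    also have "\<dots> = ennreal (real N powi (2 - int ?d) * (C0 * real N ^ (?d - 2)) * ?\<Theta> L)"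
    proof -
      have "0 \<le> C0 * real N ^ (?d - 2)" using C0 by simp
      then show ?thesis using less_imp_le[OF \<Theta>] by (simp only: ennreal_mult'')
    qed
    also have "real N powi (2 - int ?d) * (C0 * real N ^ (?d - 2)) * ?\<Theta> L = C0 / ?\<kappa> L"
    proof -
      \<comment> \<open>Dimension at least 2 makes the natural subtraction d - 2 exact, so the
        powers of N cancel.\<close>
      have "2 - int ?d = - int (?d - 2)" using dim by simp
      then have "real N powi (2 - int ?d) * real N ^ (?d - 2) = 1"
        using N by (simp add: power_int_minus del: of_nat_diff)
      then have "real N powi (2 - int ?d) * (C0 * real N ^ (?d - 2)) = C0"
        by (simp only: mult.left_commute[of _ C0] mult_1_right)
      then show ?thesis by simp
    qed
    finally have second: "ennreal (real N powi (2 - int ?d)) * D * ennreal (?\<Theta> L) \<le> ennreal (C0 / ?\<kappa> L)" .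
    show "ennreal (\<epsilon> powi (-2) * phi_of g \<rho> /
             (real N ^ CARD('d) * (\<epsilon> * real N) ^ (2 * CARD('d)) * (2 * real l + 1) ^ (2 * CARD('d)))) *
           (\<Sum>x\<in>lbox 0 (real N). \<Sum>y\<in>lbox x (\<epsilon> * real N).
              \<Sum>z\<in>{z \<in> lbox x (\<epsilon> * real N). sup_norm (z - y) \<ge> 2 * int l}.
                \<Sum>u\<in>good_points K (\<sigma> (hat \<alpha> \<omega>)) L (clus \<alpha> \<omega>) y (real l).
                  \<Sum>v\<in>good_points K (\<sigma> (hat \<alpha> \<omega>)) L (clus \<alpha> \<omega>) z (real l).
                    \<integral>\<^sup>+\<eta>. ennreal ((grad u v (\<lambda>\<xi>. sqrt (f \<xi>)) \<eta>)\<^sup>2) \<partial>nu g \<rho> (clus 0 \<omega>))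
         \<le> ennreal (real N powi (2 - int CARD('d))) * dirichlet g \<rho> \<omega> f / ennreal (?\<kappa> L)
       \<and> ennreal (real N powi (2 - int CARD('d))) * dirichlet g \<rho> \<omega> f / ennreal (?\<kappa> L)
         \<le> ennreal (C0 / ?\<kappa> L)"
      using main second unfolding div c_def times_divide_eq_left J_def D_def r_def by (rule conjI)
  qed
qed

end
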